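(* There exist absolute constants $C,a>0$ such that, with $m=m(n):=\lceil C e^{an^2}\rceil$ for $n\in\mathbb{N}$, the following holds: there are a constant $c>0$ and $n_0\in\mathbb{N}$ such that for all $n\ge n_0$ $$\frac{e^{\mathrm{ran},\mathrm{ada}}(n,\ \ell_1^m\hookrightarrow\ell_\infty^m)}{e^{\mathrm{ran},\mathrm{nonada}}(n,\ \ell_1^m\hookrightarrow\ell_\infty^m)}\ \le\ c\,\frac{\log n}{n}$$ (in particular, the denominator is positive).
   Context: $\ell_1^m$ is $\mathbb{R}^m$ with norm $\|\boldsymbol{x}\|_1=\sum_{i=1}^m|x_i|$, and $\ell_\infty^m$ is $\mathbb{R}^m$ with $\|\boldsymbol{x}\|_\infty=\max_i|x_i|$. $\ell_1^m\hookrightarrow\ell_\infty^m$ denotes the identity map regarded as an operator from $\ell_1^m$ to $\ell_\infty^m$. Let $S\colon F\to G$ be a linear operator between Banach spaces. A randomized (possibly adaptive) algorithm $A_n$ using at most $n$ linear measurements is given by a probability space $(\Omega,\Sigma,\mathbb{P})$ and, for each $\omega\in\Omega$, a rule that on input $f\in F$ computes successively $y_i=L_i(f)$, $i=1,\ldots,n$, where $L_i=L_i^{\omega}(\,\cdot\,;y_1,\ldots,y_{i-1})\in F'$ is a continuous linear functional that may depend on $\omega$ and on the previously obtained values $y_1,\ldots,y_{i-1}$, and then returns $A_n(\omega,f)=\phi^{\omega}(y_1,\ldots,y_n)\in G$. As usual, $(\omega,f)\mapsto A_n(\omega,f)$ is assumed to be jointly measurable (with respect to the product of $\Sigma$ and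 the Borel $\sigma$-algebra of $F$, and the Borel $\sigma$-algebra of $G$). The algorithm is non-adaptive if the functionals $L_i=L_i^\omega$ depend on $\omega$ only and not on previously obtained values. One writes $A_n(f)=A_n(\cdot,f)$. The Monte Carlo error is $$e(A_n,S):=\sup_{\|f\|_F\le 1}\mathbb{E}\,\|A_n(f)-S(f)\|_G.$$ $e^{\mathrm{ran},\mathrm{ada}}(n,S)=e^{\mathrm{ran}}(n,S)$ is the infimum of $e(A_n,S)$ over all (possibly adaptive) randomized algorithms using at most $n$ linear measurements, and $e^{\mathrm{ran},\mathrm{nonada}}(n,S)$ is the infimum over the non-adaptive ones only. *)

theory Defs
  imports "HOL-Probability.Probability"
begin

text \<open>
  The dimension of the spaces depends on the number of measurements, so \<open>\<real>\<^sup>m\<close> is modelled by the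
  extensional functions on \<open>{..<m}\<close> rather than by a type. All norms on \<open>\<real>\<^sup>m\<close> are equivalent;
  the Borel sets are therefore those of the product sigma-algebra, whatever the norm.
\<close>

record coord_space =
  dim :: nat
  vnorm :: "(nat \<Rightarrow> real) \<Rightarrow> real"

definition borel_vecs :: "coord_space \<Rightarrow> (nat \<Rightarrow> real) measure" where
  "borel_vecs F = (\<Pi>\<^sub>M i\<in>{..<dim F}. borel)"

definition vecs :: "coord_space \<Rightarrow> (nat \<Rightarrow> real) set" where
  "vecs F = ({..<dim F} \<rightarrow>\<^sub>E UNIV)"

definition vec_diff :: "coord_space \<Rightarrow> (nat \<Rightarrow> real) \<Rightarrow> (nat \<Rightarrow> real) \<Rightarrow> (nat \<Rightarrow> real)" where
  "vec_diff F x y = (\<lambda>i\<in>{..<dim F}. x i - y i)"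

definition ell_1 :: "nat \<Rightarrow> coord_space" where
  "ell_1 m = \<lparr>dim = m, vnorm = (\<lambda>x. \<Sum>i<m. \<bar>x i\<bar>)\<rparr>"

text \<open>The maximum is meaningful for \<open>m \<ge> 1\<close> only.\<close>

definition ell_infty :: "nat \<Rightarrow> coord_space" where
  "ell_infty m = \<lparr>dim = m, vnorm = (\<lambda>x. Max ((\<lambda>i. \<bar>x i\<bar>) ` {..<m}))\<rparr>"

definition dual :: "coord_space \<Rightarrow> ((nat \<Rightarrow> real) \<Rightarrow> real) set" where
  "dual F = {l.
     (\<forall>x\<in>vecs F. \<forall>y\<in>vecs F. \<forall>a b.
        l (\<lambda>i\<in>{..<dim F}. a * x i + b * y i) = a * l x + b * l y) \<and>
     (\<exists>K. \<forall>x\<in>vecs F. \<bar>l x\<bar> \<le> K * vnorm F x)}"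

text \<open>
  A measurement rule maps the list of the values observed so far to the next functional; the
  index of that functional is one more than the length of the list.
\<close>

type_synonym measurement = "real list \<Rightarrow> (nat \<Rightarrow> real) \<Rightarrow> real"

primrec info :: "nat \<Rightarrow> measurement \<Rightarrow> (nat \<Rightarrow> real) \<Rightarrow> real list" where
  "info 0 L f = []"
| "info (Suc k) L f = info k L f @ [L (info k L f) f]"

definition alg_out ::
    "nat \<Rightarrow> ('w \<Rightarrow> measurement) \<Rightarrow> ('w \<Rightarrow> real list \<Rightarrow> nat \<Rightarrow> real) \<Rightarrow> 'w \<Rightarrow> (nat \<Rightarrow> real) \<Rightarrow> nat \<Rightarrow> real" where
  "alg_out n L \<phi> \<omega> f = \<phi> \<omega> (info n (L \<omega>) f)"

definition randomized_alg ::
    "nat \<Rightarrow> coord_space \<Rightarrow> coord_space \<Rightarrow> 'w measure \<Rightarrow> ('w \<Rightarrow> measurement) \<Rightarrow>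
      ('w \<Rightarrow> real list \<Rightarrow> nat \<Rightarrow> real) \<Rightarrow> bool" where
  "randomized_alg n F G M L \<phi> \<longleftrightarrow>
     prob_space M \<and>
     (\<forall>\<omega>\<in>space M. \<forall>ys. length ys < n \<longrightarrow> L \<omega> ys \<in> dual F) \<and>
     (\<lambda>(\<omega>, f). alg_out n L \<phi> \<omega> f) \<in> measurable (M \<Otimes>\<^sub>M borel_vecs F) (borel_vecs G)"

definition nonadaptive :: "nat \<Rightarrow> coord_space \<Rightarrow> 'w measure \<Rightarrow> ('w \<Rightarrow> measurement) \<Rightarrow> bool" where
  "nonadaptive n F M L \<longleftrightarrow>
     (\<forall>\<omega>\<in>space M. \<forall>ys zs. length ys = length zs \<and> length ys < n \<longrightarrow>
        (\<forall>f\<in>vecs F. L \<omega> ys f = L \<omega> zs f))"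

definition mc_error ::
    "nat \<Rightarrow> coord_space \<Rightarrow> coord_space \<Rightarrow> ((nat \<Rightarrow> real) \<Rightarrow> (nat \<Rightarrow> real)) \<Rightarrow> 'w measure \<Rightarrow>
      ('w \<Rightarrow> measurement) \<Rightarrow> ('w \<Rightarrow> real list \<Rightarrow> nat \<Rightarrow> real) \<Rightarrow> ennreal" where
  "mc_error n F G S M L \<phi> =
     (SUP f\<in>{f \<in> vecs F. vnorm F f \<le> 1}.
        \<integral>\<^sup>+ \<omega>. ennreal (vnorm G (vec_diff G (alg_out n L \<phi> \<omega> f) (S f))) \<partial>M)"

text \<open>
  The infima range over all probability spaces whose underlying set consists of real numbers, with
  arbitrary sigma-algebras. This loses nothing: by \<open>sample_space_real\<close> below, an algorithm on a
  probability space over any type has a counterpart on such a space with the same error (and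
  non-adaptivity is preserved).
\<close>

definition e_ran_ada ::
    "nat \<Rightarrow> coord_space \<Rightarrow> coord_space \<Rightarrow> ((nat \<Rightarrow> real) \<Rightarrow> (nat \<Rightarrow> real)) \<Rightarrow> ennreal" where
  "e_ran_ada n F G S =
     Inf {mc_error n F G S M L \<phi> | (M :: real measure) L \<phi>. randomized_alg n F G M L \<phi>}"

definition e_ran_nonada ::
    "nat \<Rightarrow> coord_space \<Rightarrow> coord_space \<Rightarrow> ((nat \<Rightarrow> real) \<Rightarrow> (nat \<Rightarrow> real)) \<Rightarrow> ennreal" where
  "e_ran_nonada n F G S =
     Inf {mc_error n F G S M L \<phi> | (M :: real measure) L \<phi>.
            randomized_alg n F G M L \<phi> \<and> nonadaptive n F M L}"

lemma pair_set_countably_generated: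
  assumes "E \<in> sets (M \<Otimes>\<^sub>M N)"
  shows "\<exists>C. countable C \<and> C \<subseteq> sets M \<and> E \<in> sets (sigma (space M) C \<Otimes>\<^sub>M N)"
proof -
  have mono: "E \<in> sets (sigma (space M) D \<Otimes>\<^sub>M N)"
    if "E \<in> sets (sigma (space M) C \<Otimes>\<^sub>M N)" "C \<subseteq> D" "D \<subseteq> sets M" for C D E
  proof -
    have DP: "D \<subseteq> Pow (space M)" and CP: "C \<subseteq> Pow (space M)"
      using that sets.space_closed[of M] by auto
    have "sets (sigma (space M) C \<Otimes>\<^sub>M N) \<subseteq> sets (sigma (space M) D \<Otimes>\<^sub>M N)"
      unfolding sets_pair_measure space_measure_of[OF DP] space_measure_of[OF CP]
    proof (rule sigma_sets_mono')
      show "{a \<times> b |a b. a \<in> sets (sigma (space M) C) \<and> b \<in> sets N}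
        \<subseteq> {a \<times> b |a b. a \<in> sets (sigma (space M) D) \<and> b \<in> sets N}"
        using sigma_sets_mono'[OF that(2), of "space M"]
        unfolding sets_measure_of[OF CP] sets_measure_of[OF DP] by blast
    qed
    then show ?thesis using that by auto
  qed
  from assms have "E \<in> sigma_sets (space M \<times> space N) {a \<times> b |a b. a \<in> sets M \<and> b \<in> sets N}"
    by (simp add: sets_pair_measure)
  then show ?thesis
  proof induction
    case (Basic E)
    then obtain a b where ab: "E = a \<times> b" "a \<in> sets M" "b \<in> sets N" by auto
    have "a \<in> sets (sigma (space M) {a})"
      using sets.sets_into_space[OF ab(2)] by (simp add: sets_measure_of)
    then have "E \<in> sets (sigma (space M) {a} \<Otimes>\<^sub>M N)"
      using ab by auto
    then show ?case using ab by (intro exI[of _ "{a}"]) auto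
  next
    case Empty
    show ?case by (intro exI[of _ "{}"]) auto
  next
    case (Compl E)
    then obtain C where C: "countable C" "C \<subseteq> sets M" "E \<in> sets (sigma (space M) C \<Otimes>\<^sub>M N)"
      by auto
    have CP: "C \<subseteq> Pow (space M)" using C sets.space_closed[of M] by auto
    have "space (sigma (space M) C \<Otimes>\<^sub>M N) - E \<in> sets (sigma (space M) C \<Otimes>\<^sub>M N)"
      using C(3) by (rule sets.compl_sets)
    then have "space M \<times> space N - E \<in> sets (sigma (space M) C \<Otimes>\<^sub>M N)"
      by (simp add: space_pair_measure space_measure_of[OF CP])
    then show ?case using C by blast
  next
    case (Union A)
    then obtain C where C: "\<And>i. countable (C i)" "\<And>i. C i \<subseteq> sets M"
      "\<And>i. A i \<in> sets (sigma (space M) (C i) \<Otimes>\<^sub>M N)"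
      by metis
    have "A i \<in> sets (sigma (space M) (\<Union>i. C i) \<Otimes>\<^sub>M N)" for i
      by (rule mono[OF C(3)[of i]]) (use C in auto)
    then have "(\<Union>i. A i) \<in> sets (sigma (space M) (\<Union>i. C i) \<Otimes>\<^sub>M N)"
      by auto
    then show ?case using C by (intro exI[of _ "\<Union>i. C i"]) auto
  qed
qed

lemma alg_sets_countably_generated:
  fixes A :: "'w \<times> 'f \<Rightarrow> nat \<Rightarrow> real"
  assumes A: "A \<in> measurable (M \<Otimes>\<^sub>M N) (\<Pi>\<^sub>M i\<in>{..<q}. borel)"
  shows "\<exists>C. countable C \<and> C \<subseteq> sets M \<and>
    A \<in> measurable (sigma (space M) C \<Otimes>\<^sub>M N) (\<Pi>\<^sub>M i\<in>{..<q}. borel)"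
proof -
  obtain B :: "real set set" where B: "countable B" "topological_basis B"
    using ex_countable_basis by auto
  define E where "E i b = (\<lambda>x. A x i) -` b \<inter> (space M \<times> space N)" for i b
  have "E i b \<in> sets (M \<Otimes>\<^sub>M N)" if "i < q" "b \<in> B" for i b
  proof -
    have "(\<lambda>x. A x i) \<in> measurable (M \<Otimes>\<^sub>M N) borel"
      using measurable_compose[OF A measurable_component_singleton[of i "{..<q}"]] that by auto
    moreover have "b \<in> sets borel"
      using topological_basis_open[OF B(2) that(2)] by auto
    ultimately show ?thesis
      unfolding E_def by (metis measurable_sets space_pair_measure)
  qed
  then have "\<forall>i b. \<exists>C. i < q \<longrightarrow> b \<in> B \<longrightarrow>
      countable C \<and> C \<subseteq> sets M \<and> E i b \<in> sets (sigma (space M) C \<Otimes>\<^sub>M N)"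
    using pair_set_countably_generated by metis
  then obtain c where c: "\<And>i b. i < q \<Longrightarrow> b \<in> B \<Longrightarrow>
      countable (c i b) \<and> c i b \<subseteq> sets M \<and> E i b \<in> sets (sigma (space M) (c i b) \<Otimes>\<^sub>M N)"
    by metis
  define C where "C = (\<Union>i<q. \<Union>b\<in>B. c i b)"
  have C: "countable C" "C \<subseteq> sets M"
    unfolding C_def using c B(1) by (auto intro!: countable_UN)
  have CP: "D \<subseteq> Pow (space M)" if "D \<subseteq> sets M" for D
    using that sets.space_closed[of M] by auto
  have E: "E i b \<in> sets (sigma (space M) C \<Otimes>\<^sub>M N)" if ib: "i < q" "b \<in> B" for i b
  proof -
    have sub: "c i b \<subseteq> C" "c i b \<subseteq> sets M" using ib c C_def by auto
    have "sets (sigma (space M) (c i b) \<Otimes>\<^sub>M N) \<subseteq> sets (sigma (space M) C \<Otimes>\<^sub>M N)"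
      unfolding sets_pair_measure space_measure_of[OF CP[OF C(2)]] space_measure_of[OF CP[OF sub(2)]]
    proof (rule sigma_sets_mono')
      show "{a \<times> b' |a b'. a \<in> sets (sigma (space M) (c i b)) \<and> b' \<in> sets N}
        \<subseteq> {a \<times> b' |a b'. a \<in> sets (sigma (space M) C) \<and> b' \<in> sets N}"
        using sigma_sets_mono'[OF sub(1), of "space M"]
        unfolding sets_measure_of[OF CP[OF C(2)]] sets_measure_of[OF CP[OF sub(2)]] by blast
    qed
    then show ?thesis using c ib by auto
  qed
  have sp: "space (sigma (space M) C \<Otimes>\<^sub>M N) = space M \<times> space N"
    by (simp add: space_pair_measure space_measure_of[OF CP[OF C(2)]])
  have coord: "(\<lambda>x. A x i) \<in> measurable (sigma (space M) C \<Otimes>\<^sub>M N) borel" if "i < q" for i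
    unfolding borel_eq_countable_basis[OF B]
    by (rule measurable_measure_of) (use E[OF that] sp in \<open>auto simp: E_def\<close>)
  have "A \<in> measurable (sigma (space M) C \<Otimes>\<^sub>M N) (\<Pi>\<^sub>M i\<in>{..<q}. borel)"
  proof (rule measurable_PiM_single')
    show "(\<lambda>x. A x i) \<in> measurable (sigma (space M) C \<Otimes>\<^sub>M N) borel" if "i \<in> {..<q}" for i
      using coord that by auto
    show "A \<in> space (sigma (space M) C \<Otimes>\<^sub>M N) \<rightarrow> (\<Pi>\<^sub>E i\<in>{..<q}. space borel)"
      using measurable_space[OF A] unfolding sp by (auto simp: space_PiM space_pair_measure)
  qed
  then show ?thesis using C by blast
qed

lemma sample_space_real:
  fixes M :: "'w measure"
  assumes alg: "randomized_alg n F G M L \<phi>"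
    and norm: "vnorm G \<in> borel_measurable (borel_vecs G)"
  obtains M' :: "real measure" and L' \<phi>' where
    "randomized_alg n F G M' L' \<phi>'"
    "mc_error n F G S M' L' \<phi>' = mc_error n F G S M L \<phi>"
    "nonadaptive n F M L \<Longrightarrow> nonadaptive n F M' L'"
proof -
  interpret prob_space M using alg by (simp add: randomized_alg_def)
  let ?A = "\<lambda>(\<omega>, f). alg_out n L \<phi> \<omega> f"
  have A: "?A \<in> measurable (M \<Otimes>\<^sub>M borel_vecs F) (borel_vecs G)"
    using alg by (simp add: randomized_alg_def)
  obtain C where C: "countable C" "C \<subseteq> sets M"
    and AC: "?A \<in> measurable (sigma (space M) C \<Otimes>\<^sub>M borel_vecs F) (borel_vecs G)"
    using alg_sets_countably_generated[OF A[unfolded borel_vecs_def[of G]]]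
    unfolding borel_vecs_def[of G] by blast
  have CP: "C \<subseteq> Pow (space M)" using C(2) sets.space_closed[of M] by auto
  obtain h :: "nat set \<Rightarrow> real" where h: "inj h"
    using nat_sets_eqpoll_reals unfolding eqpoll_def bij_betw_def by blast
  define X where "X \<omega> = h (to_nat_on C ` {c \<in> C. \<omega> \<in> c})" for \<omega>
  have X_eq: "(\<omega> \<in> c) = (\<omega>' \<in> c)" if "X \<omega> = X \<omega>'" "c \<in> C" for \<omega> \<omega>' c
  proof -
    have "to_nat_on C ` {c \<in> C. \<omega> \<in> c} = to_nat_on C ` {c \<in> C. \<omega>' \<in> c}"
      using that(1) h unfolding X_def by (auto dest: injD)
    then have "{c \<in> C. \<omega> \<in> c} = {c \<in> C. \<omega>' \<in> c}"
      using inj_on_to_nat_on[OF C(1)]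
      by (subst (asm) inj_on_image_eq_iff[where C = C]) auto
    then show ?thesis using that(2) by blast
  qed
  define \<Omega>' where "\<Omega>' = X ` space M"
  define \<Sigma>' where "\<Sigma>' = {B. B \<subseteq> \<Omega>' \<and> X -` B \<inter> space M \<in> sets M}"
  define s where "s = inv_into (space M) X"
  have s: "s x \<in> space M" "X (s x) = x" if "x \<in> \<Omega>'" for x
    using that unfolding s_def \<Omega>'_def by (auto intro: inv_into_into f_inv_into_f)
  have alg\<Sigma>: "sigma_algebra \<Omega>' \<Sigma>'"
  proof (rule sigma_algebra_iff2[THEN iffD2], intro conjI ballI allI impI)
    show "\<Sigma>' \<subseteq> Pow \<Omega>'" "{} \<in> \<Sigma>'" by (auto simp: \<Sigma>'_def)
  next
    fix B assume B: "B \<in> \<Sigma>'"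
    have "X -` (\<Omega>' - B) \<inter> space M = space M - (X -` B \<inter> space M)"
      by (auto simp: \<Omega>'_def)
    then show "\<Omega>' - B \<in> \<Sigma>'" using B by (auto simp: \<Sigma>'_def)
  next
    fix B :: "nat \<Rightarrow> real set" assume "range B \<subseteq> \<Sigma>'"
    then have B: "B i \<subseteq> \<Omega>'" "X -` B i \<inter> space M \<in> sets M" for i by (auto simp: \<Sigma>'_def)
    have "X -` (\<Union>i. B i) \<inter> space M = (\<Union>i. X -` B i \<inter> space M)" by auto
    also have "\<dots> \<in> sets M" using B(2) by (intro sets.countable_UN) auto
    finally show "(\<Union>i. B i) \<in> \<Sigma>'" using B(1) by (auto simp: \<Sigma>'_def)
  qed
  define K where "K = sigma \<Omega>' \<Sigma>'"
  have \<Sigma>P: "\<Sigma>' \<subseteq> Pow \<Omega>'" by (auto simp: \<Sigma>'_def)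
  have K: "space K = \<Omega>'" "sets K = \<Sigma>'"
    unfolding K_def using \<Sigma>P sigma_algebra.sigma_sets_eq[OF alg\<Sigma>]
    by (simp_all add: space_measure_of sets_measure_of)
  have X: "X \<in> measurable M K"
    by (rule measurableI) (auto simp: K \<Sigma>'_def \<Omega>'_def)
  define M' where "M' = distr M K X"
  define L' where "L' x = L (s x)" for x
  define \<phi>' where "\<phi>' x = \<phi> (s x)" for x
  have M': "space M' = \<Omega>'" "sets M' = \<Sigma>'" by (simp_all add: M'_def K)
  have sm: "s \<in> measurable M' (sigma (space M) C)"
  proof (rule measurable_measure_of[OF CP])
    show "s \<in> space M' \<rightarrow> space M" using s M' by auto
    fix c assume c: "c \<in> C"
    have eq: "X -` (s -` c \<inter> \<Omega>') \<inter> space M = c"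
    proof -
      have "(s (X \<omega>) \<in> c) = (\<omega> \<in> c)" if "\<omega> \<in> space M" for \<omega>
        by (rule X_eq[OF _ c], rule s(2)) (use that in \<open>simp add: \<Omega>'_def\<close>)
      moreover have "X \<omega> \<in> \<Omega>'" if "\<omega> \<in> space M" for \<omega>
        using that by (simp add: \<Omega>'_def)
      ultimately show ?thesis using c CP by blast
    qed
    have "s -` c \<inter> \<Omega>' \<in> \<Sigma>'" using c C(2) eq by (auto simp: \<Sigma>'_def)
    then show "s -` c \<inter> space M' \<in> sets M'" by (simp add: M')
  qed
  have meas': "(\<lambda>(x, f). alg_out n L' \<phi>' x f) \<in> measurable (M' \<Otimes>\<^sub>M borel_vecs F) (borel_vecs G)"
  proof -
    have "(\<lambda>p. (s (fst p), snd p)) \<in>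
        measurable (M' \<Otimes>\<^sub>M borel_vecs F) (sigma (space M) C \<Otimes>\<^sub>M borel_vecs F)"
      by (intro measurable_Pair measurable_compose[OF measurable_fst sm] measurable_snd)
    from measurable_compose[OF this AC] show ?thesis
      by (simp add: alg_out_def L'_def \<phi>'_def case_prod_beta)
  qed
  have alg': "randomized_alg n F G M' L' \<phi>'"
    unfolding randomized_alg_def
  proof (intro conjI ballI allI impI)
    show "prob_space M'" unfolding M'_def by (rule prob_space_distr[OF X])
    show "L' x ys \<in> dual F" if "x \<in> space M'" "length ys < n" for x ys
      using alg s(1)[of x] that unfolding randomized_alg_def L'_def M' by blast
  qed (rule meas')
  have spC: "space (sigma (space M) C) = space M" by (simp add: space_measure_of[OF CP])
  have same: "alg_out n L \<phi> (s (X \<omega>)) f = alg_out n L \<phi> \<omega> f"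
    if \<omega>: "\<omega> \<in> space M" and f: "f \<in> vecs F" for \<omega> f
  proof -
    have f': "f \<in> space (borel_vecs F)" using f by (simp add: borel_vecs_def vecs_def space_PiM)
    have m: "(\<lambda>\<omega>. alg_out n L \<phi> \<omega> f) \<in> measurable (sigma (space M) C) (borel_vecs G)"
      using measurable_compose[OF measurable_Pair2'[OF f'] AC] by simp
    have sX: "s (X \<omega>) \<in> space M" "X (s (X \<omega>)) = X \<omega>"
      by (rule s, use \<omega> in \<open>simp add: \<Omega>'_def\<close>)+
    have sat: "(s (X \<omega>) \<in> T) = (\<omega> \<in> T)" if "T \<in> sigma_sets (space M) C" for T
      using that
    proof induction
      case (Basic c) then show ?case using X_eq sX by blast
    qed (use sX \<omega> in auto)
    show ?thesis
    proof
      fix i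
      show "alg_out n L \<phi> (s (X \<omega>)) f i = alg_out n L \<phi> \<omega> f i"
      proof (cases "i < dim G")
        case True
        have mi: "(\<lambda>\<omega>. alg_out n L \<phi> \<omega> f i) \<in> measurable (sigma (space M) C) borel"
          using measurable_compose[OF m[unfolded borel_vecs_def]
              measurable_component_singleton[of i "{..<dim G}"]] True by auto
        have "(\<lambda>\<omega>. alg_out n L \<phi> \<omega> f i) -` {alg_out n L \<phi> \<omega> f i} \<inter> space M \<in> sigma_sets (space M) C"
          using measurable_sets[OF mi, of "{alg_out n L \<phi> \<omega> f i}"] spC
          by (simp add: sets_measure_of[OF CP])
        from sat[OF this] show ?thesis using \<omega> by auto
      next
        case False
        then show ?thesis
          using measurable_space[OF m, of \<omega>] measurable_space[OF m, of "s (X \<omega>)"] sX \<omega>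
          by (auto simp: spC borel_vecs_def space_PiM PiE_def extensional_def)
      qed
    qed
  qed
  have err: "mc_error n F G S M' L' \<phi>' = mc_error n F G S M L \<phi>"
    unfolding mc_error_def
  proof (rule SUP_cong[OF refl])
    fix f assume "f \<in> {f \<in> vecs F. vnorm F f \<le> 1}"
    then have f: "f \<in> vecs F" by simp
    let ?g = "\<lambda>\<omega>. ennreal (vnorm G (vec_diff G (alg_out n L \<phi> \<omega> f) (S f)))"
    have out': "alg_out n L' \<phi>' x f = alg_out n L \<phi> (s x) f" for x
      by (simp add: alg_out_def L'_def \<phi>'_def)
    show "(\<integral>\<^sup>+ x. ennreal (vnorm G (vec_diff G (alg_out n L' \<phi>' x f) (S f))) \<partial>M') = (\<integral>\<^sup>+ \<omega>. ?g \<omega> \<partial>M)"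
      (is "?lhs = _")
    proof -
      have f': "f \<in> space (borel_vecs F)" using f by (simp add: borel_vecs_def vecs_def space_PiM)
      have diff: "(\<lambda>y. vec_diff G y (S f)) \<in> measurable (borel_vecs G) (borel_vecs G)"
        unfolding vec_diff_def borel_vecs_def by measurable
      have o: "(\<lambda>x. alg_out n L' \<phi>' x f) \<in> measurable M' (borel_vecs G)"
        using measurable_compose[OF measurable_Pair2'[OF f'] meas'] by simp
      have "(\<lambda>x. vnorm G (vec_diff G (alg_out n L' \<phi>' x f) (S f))) \<in> borel_measurable M'"
        using measurable_compose[OF measurable_compose[OF o diff] norm] .
      then have "(\<lambda>x. ennreal (vnorm G (vec_diff G (alg_out n L' \<phi>' x f) (S f)))) \<in> borel_measurable (distr M K X)"
        unfolding M'_def by simp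
      then have "?lhs = (\<integral>\<^sup>+ \<omega>. ennreal (vnorm G (vec_diff G (alg_out n L' \<phi>' (X \<omega>) f) (S f))) \<partial>M)"
        unfolding M'_def by (rule nn_integral_distr[OF X])
      also have "\<dots> = (\<integral>\<^sup>+ \<omega>. ?g \<omega> \<partial>M)"
        by (rule nn_integral_cong) (simp add: out' same[OF _ f])
      finally show ?thesis .
    qed
  qed
  have na: "nonadaptive n F M' L'" if "nonadaptive n F M L"
    using that s(1) unfolding nonadaptive_def M' L'_def by blast
  show thesis by (rule that[OF alg' err na])
qed

end

theory Submission
  imports Defs "HOL-Real_Asymp.Real_Asymp"
begin

text \<open>
  Lower bound for non-adaptive methods. Hide a spike \<open>e\<^sub>i/2\<close> in noise that is uniform on a cube of side
  \<open>1/s\<close> in the coordinates of a random set \<open>J\<close> of size \<open>s = 4n\<close>. Among any \<open>n + 1\<close> columns of the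
  measurement matrix, one is a combination of the others with coefficients in \<open>[-1, 1]\<close>; hence for
  most pairs \<open>(J, i)\<close> the spike has the same measurements as a shift of the noise by a vector in
  \<open>[-1/2, 1/2]\<^sup>J\<close>. The inputs from which different \<open>i\<close> are identified then become disjoint sets in a
  cube that is only \<open>(1 + s)\<^sup>s\<close> times as large as the noise cube, so that a random one of \<open>m\<close> spikes
  is missed with constant probability once \<open>m\<close> exceeds a multiple of \<open>(1 + s)\<^sup>s\<close>.

  Upper bound for adaptive methods. Hash the coordinates into polynomially many cells and find the
  at most \<open>D\<close> heavy cells, where \<open>D\<close> is of order \<open>n / log n\<close>, from majority votes over \<open>O(log n)\<close>
  random groupings of the cells into \<open>16 D\<close> groups. In a heavy cell with one dominating coordinate,
  the quotient of a weighted and an unweighted sum reveals the next digit of the hash value of that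
  coordinate. Restricting to the subcell lowers the noise, so the next digit may be twice as long,
  and \<open>O(log log m)\<close> such steps give the coordinate itself, whose value is then measured exactly.
\<close>

section \<open>The non-adaptive lower bound\<close>

text \<open>Gaussian elimination: a vector \<open>p\<close> with nonzero last coordinate serves as
  pivot, and subtracting its multiples from the others leaves one equation and one vector
  fewer.\<close>

lemma underdetermined_system:
  fixes c :: "'a \<Rightarrow> nat \<Rightarrow> real"
  assumes "finite B" "n < card B"
  shows "\<exists>v. (\<exists>i\<in>B. v i \<noteq> 0) \<and> (\<forall>k<n. (\<Sum>i\<in>B. v i * c i k) = 0)"
  using assms
proof (induction n arbitrary: B c)
  case 0
  then obtain i where "i \<in> B" by (metis card_gt_0_iff ex_in_conv)
  then show ?case by (intro exI[of _ "\<lambda>_. 1"]) auto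
next
  case (Suc n)
  show ?case
  proof (cases "\<forall>i\<in>B. c i n = 0")
    case True
    from Suc.IH[OF Suc.prems(1), of c] Suc.prems
    obtain v where v: "\<exists>i\<in>B. v i \<noteq> 0" "\<forall>k<n. (\<Sum>i\<in>B. v i * c i k) = 0" by auto
    have "(\<Sum>i\<in>B. v i * c i n) = 0" using True by simp
    with v show ?thesis by (intro exI[of _ v]) (auto simp: less_Suc_eq)
  next
    case False
    then obtain p where p: "p \<in> B" "c p n \<noteq> 0" by blast
    let ?B = "B - {p}"
    define c' where "c' i k = c i k - c i n / c p n * c p k" for i k
    have "finite ?B" "n < card ?B" using Suc.prems p by auto
    from Suc.IH[OF this, of c'] obtain v
      where v: "\<exists>i\<in>?B. v i \<noteq> 0" "\<forall>k<n. (\<Sum>i\<in>?B. v i * c' i k) = 0" by blast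
    \<comment> \<open>The coefficient at the pivot is the one that solves equation \<open>n\<close>;
      with it the sums for \<open>w\<close> and \<open>c\<close> coincide with those for
      \<open>v\<close> and \<open>c'\<close>.\<close>
    define w where "w i = (if i = p then - (\<Sum>i\<in>?B. v i * c i n) / c p n else v i)" for i
    have eq: "(\<Sum>i\<in>B. w i * c i k) = (\<Sum>i\<in>?B. v i * c' i k)" for k
    proof -
      have "(\<Sum>i\<in>B. w i * c i k) = w p * c p k + (\<Sum>i\<in>?B. w i * c i k)"
        by (rule sum.remove[OF Suc.prems(1) p(1)])
      also have "(\<Sum>i\<in>?B. w i * c i k) = (\<Sum>i\<in>?B. v i * c i k)"
        by (rule sum.cong) (auto simp: w_def)
      also have "w p * c p k + \<dots> = (\<Sum>i\<in>?B. v i * c' i k)"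
        by (simp add: w_def c'_def right_diff_distrib sum_subtractf sum_distrib_left
            sum_distrib_right sum_divide_distrib mult.assoc)
      finally show ?thesis .
    qed
    have "(\<Sum>i\<in>?B. v i * c' i n) = 0" using p by (simp add: c'_def)
    then have "\<forall>k<Suc n. (\<Sum>i\<in>B. w i * c i k) = 0"
      using v(2) by (auto simp: eq less_Suc_eq)
    moreover have "\<exists>i\<in>B. w i \<noteq> 0" using v(1) by (auto simp: w_def)
    ultimately show ?thesis by blast
  qed
qed

text \<open>The bound on the coefficients matters: a spike of height 1/2 then has the measurements
  of a shift by at most 1/2 in each coordinate of \<open>J\<close>, so the shifted noise stays in a
  cube of controlled size.\<close>

definition spanned :: "nat \<Rightarrow> ('a \<Rightarrow> nat \<Rightarrow> real) \<Rightarrow> 'a set \<Rightarrow> 'a \<Rightarrow> bool" where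
  "spanned n c J i \<longleftrightarrow>
     (\<exists>a. (\<forall>j. \<bar>a j\<bar> \<le> 1) \<and> (\<forall>k<n. c i k = (\<Sum>j\<in>J. a j * c j k)))"

text \<open>The dependence is sought among the failing elements alone, so that the element it shows
  to be spanned is a failing one.\<close>

lemma card_not_spanned:
  assumes K: "finite K"
  shows "card {i \<in> K. \<not> spanned n c (K - {i}) i} \<le> n"
proof (rule ccontr)
  define B where "B = {i \<in> K. \<not> spanned n c (K - {i}) i}"
  assume "\<not> ?thesis"
  then have "n < card B" by (simp add: B_def)
  moreover have B: "finite B" "B \<subseteq> K" using K by (auto simp: B_def)
  ultimately obtain v where v: "\<exists>i\<in>B. v i \<noteq> 0" "\<forall>k<n. (\<Sum>i\<in>B. v i * c i k) = 0"
    using underdetermined_system[of B n c] by blast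
  have "Max ((\<lambda>i. \<bar>v i\<bar>) ` B) \<in> (\<lambda>i. \<bar>v i\<bar>) ` B"
    by (rule Max_in) (use B v in auto)
  then obtain p where p: "p \<in> B" "\<bar>v p\<bar> = Max ((\<lambda>i. \<bar>v i\<bar>) ` B)" by auto
  have le: "\<bar>v i\<bar> \<le> \<bar>v p\<bar>" if "i \<in> B" for i
    using that B p by simp
  with v(1) have vp: "v p \<noteq> 0" by fastforce
  \<comment> \<open>In a linear dependence the vector with the largest coefficient is spanned by the others.\<close>
  define a where "a j = (if j \<in> B then - v j / v p else 0)" for j
  have "c p k = (\<Sum>j\<in>K - {p}. a j * c j k)" if "k < n" for k
  proof -
    have "0 = v p * c p k + (\<Sum>j\<in>B - {p}. v j * c j k)"
      using v(2) that sum.remove[OF B(1) p(1)] by metis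
    then have "c p k = - (\<Sum>j\<in>B - {p}. v j * c j k) / v p"
      using vp by (simp add: field_simps)
    also have "\<dots> = (\<Sum>j\<in>B - {p}. a j * c j k)"
      by (simp add: a_def sum_divide_distrib sum_negf)
    also have "\<dots> = (\<Sum>j\<in>K - {p}. a j * c j k)"
      by (rule sum.mono_neutral_left) (use K B in \<open>auto simp: a_def\<close>)
    finally show ?thesis .
  qed
  moreover have "\<bar>a j\<bar> \<le> 1" for j
    using le[of j] vp by (auto simp: a_def field_simps)
  ultimately have "spanned n c (K - {p}) p" unfolding spanned_def by blast
  with p(1) show False by (simp add: B_def)
qed

text \<open>Double counting: adding \<open>i\<close> to \<open>J\<close> turns pairs with
  \<open>i\<close> outside \<open>J\<close> into pairs with \<open>i\<close> in \<open>K\<close>.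
  For each fixed \<open>K\<close> the number of unspanned \<open>i\<close> is bounded by
  \<open>card_not_spanned\<close>.\<close>

lemma sum_subset_complement:
  fixes g :: "'a set \<Rightarrow> 'a \<Rightarrow> 'b::comm_monoid_add"
  assumes "finite X"
  shows "(\<Sum>J | J \<subseteq> X \<and> card J = s. \<Sum>i\<in>X - J. g J i)
    = (\<Sum>K | K \<subseteq> X \<and> card K = Suc s. \<Sum>i\<in>K. g (K - {i}) i)"
proof -
  have fin: "finite {J. J \<subseteq> X \<and> card J = s}" for s using assms by auto
  have sub: "finite K" if "K \<subseteq> X" for K using that assms finite_subset by blast
  have "(\<Sum>J | J \<subseteq> X \<and> card J = s. \<Sum>i\<in>X - J. g J i)
      = (\<Sum>(J, i)\<in>Sigma {J. J \<subseteq> X \<and> card J = s} (\<lambda>J. X - J). g J i)"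
    using assms by (intro sum.Sigma fin) auto
  also have "\<dots> = (\<Sum>(K, i)\<in>Sigma {K. K \<subseteq> X \<and> card K = Suc s} (\<lambda>K. K). g (K - {i}) i)"
    by (rule sum.reindex_bij_witness[where i = "\<lambda>(K, i). (K - {i}, i)" and j = "\<lambda>(J, i). (insert i J, i)"])
      (auto simp: card_insert_if card_Diff_singleton sub)
  also have "\<dots> = (\<Sum>K | K \<subseteq> X \<and> card K = Suc s. \<Sum>i\<in>K. g (K - {i}) i)"
    using sub by (intro sum.Sigma[symmetric] fin) auto
  finally show ?thesis .
qed

section \<open>Noise cubes, spiked inputs and their volumes\<close>

text \<open>Measures on a finite product are determined by boxes, where the claim factors into
  translation invariance on the line.\<close>

lemma distr_PiM_lborel_shift:
  fixes a :: "'i \<Rightarrow> real"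
  assumes J: "finite J"
  shows "distr (\<Pi>\<^sub>M j\<in>J. lborel) (\<Pi>\<^sub>M j\<in>J. lborel) (\<lambda>u. \<lambda>j\<in>J. u j + a j) = (\<Pi>\<^sub>M j\<in>J. lborel)"
    (is "distr ?P ?P ?T = _")
proof -
  interpret product_sigma_finite "\<lambda>_::'i. lborel :: real measure" by standard
  have T: "?T \<in> measurable ?P ?P" by measurable
  show ?thesis
  proof (rule PiM_eqI[OF J])
    fix A :: "'i \<Rightarrow> real set" assume A: "\<And>i. i \<in> J \<Longrightarrow> A i \<in> sets lborel"
    have A': "(\<lambda>x. x + a i) -` A i \<in> sets lborel" if "i \<in> J" for i
      using measurable_sets[of "\<lambda>x. x + a i" lborel lborel "A i"] A[OF that] by simp
    have "emeasure (distr ?P ?P ?T) (Pi\<^sub>E J A) = emeasure ?P (?T -` Pi\<^sub>E J A \<inter> space ?P)"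
      by (rule emeasure_distr[OF T]) (use A J in auto)
    also have "?T -` Pi\<^sub>E J A \<inter> space ?P = (\<Pi>\<^sub>E i\<in>J. (\<lambda>x. x + a i) -` A i)"
      by (auto simp: space_PiM PiE_def Pi_def)
    also have "emeasure ?P \<dots> = (\<Prod>i\<in>J. emeasure lborel ((\<lambda>x. x + a i) -` A i))"
      by (rule emeasure_PiM[OF J A'])
    also have "\<dots> = (\<Prod>i\<in>J. emeasure lborel (A i))"
    proof (rule prod.cong[OF refl])
      fix i assume i: "i \<in> J"
      have "emeasure lborel (A i) = emeasure (distr lborel borel ((+) (a i))) (A i)"
        by (simp add: lborel_distr_plus)
      also have "\<dots> = emeasure lborel ((\<lambda>x. x + a i) -` A i)"
        using A[OF i] by (subst emeasure_distr) (auto simp: add.commute intro!: arg_cong2[where f=emeasure])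
      finally show "emeasure lborel ((\<lambda>x. x + a i) -` A i) = emeasure lborel (A i)" ..
    qed
    finally show "emeasure (distr ?P ?P ?T) (Pi\<^sub>E J A) = (\<Prod>i\<in>J. emeasure lborel (A i))" .
  qed simp
qed

definition unit_vec :: "nat \<Rightarrow> nat \<Rightarrow> nat \<Rightarrow> real" where
  "unit_vec m i = (\<lambda>k\<in>{..<m}. if k = i then 1 else 0)"

text \<open>\<open>dual\<close> gives linearity only for combinations of two vectors, so
  \<open>f\<close> is built from its truncations \<open>tr q\<close>, one coordinate at a
  time.\<close>

lemma dual_expand:
  assumes l: "l \<in> dual F" and f: "f \<in> vecs F"
  shows "l f = (\<Sum>i<dim F. f i * l (unit_vec (dim F) i))"
proof -
  let ?m = "dim F"
  have lin: "l (\<lambda>i\<in>{..<?m}. a * x i + b * y i) = a * l x + b * l y"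
    if "x \<in> vecs F" "y \<in> vecs F" for x y a b
    using l that by (auto simp: dual_def)
  define tr where "tr q = (\<lambda>k\<in>{..<?m}. if k < q then f k else 0)" for q
  have tr: "tr q \<in> vecs F" for q by (auto simp: tr_def vecs_def)
  have unit: "unit_vec ?m i \<in> vecs F" for i by (auto simp: unit_vec_def vecs_def)
  have "l (tr q) = (\<Sum>i<q. f i * l (unit_vec ?m i))" if "q \<le> ?m" for q
    using that
  proof (induction q)
    case 0
    have "tr 0 = (\<lambda>i\<in>{..<?m}. 0 * tr 0 i + 0 * tr 0 i)" by (auto simp: tr_def)
    then have "l (tr 0) = 0 * l (tr 0) + 0 * l (tr 0)" using lin[OF tr tr] by metis
    then show ?case by simp
  next
    case (Suc q)
    have "tr (Suc q) = (\<lambda>i\<in>{..<?m}. 1 * tr q i + f q * unit_vec ?m q i)"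
      by (auto simp: tr_def unit_vec_def fun_eq_iff less_Suc_eq)
    then have "l (tr (Suc q)) = 1 * l (tr q) + f q * l (unit_vec ?m q)"
      using lin[OF tr unit] by metis
    then show ?case using Suc by simp
  qed
  from this[of ?m] have "l (tr ?m) = (\<Sum>i<?m. f i * l (unit_vec ?m i))" by simp
  moreover have "tr ?m = f"
    using f by (auto simp: tr_def vecs_def fun_eq_iff PiE_def extensional_def)
  ultimately show ?thesis by simp
qed

definition embed :: "nat \<Rightarrow> nat set \<Rightarrow> (nat \<Rightarrow> real) \<Rightarrow> nat \<Rightarrow> real" where
  "embed m J u = (\<lambda>k\<in>{..<m}. if k \<in> J then u k else 0)"

text \<open>The spike takes half of the available norm; noise of size at most
  \<open>1 / (2 * s)\<close> on \<open>s\<close> coordinates takes at most the other half.\<close>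

definition spiked :: "nat \<Rightarrow> nat set \<Rightarrow> nat \<Rightarrow> (nat \<Rightarrow> real) \<Rightarrow> nat \<Rightarrow> real" where
  "spiked m J i z = (\<lambda>k\<in>{..<m}. (if k \<in> J then z k else 0) + (if k = i then 1/2 else 0))"

definition box :: "nat set \<Rightarrow> real \<Rightarrow> (nat \<Rightarrow> real) set" where
  "box J r = (\<Pi>\<^sub>E j\<in>J. {-r..r})"

text \<open>The threshold lies midway between the spike and zero. Two different indices below
  \<open>m\<close> cannot both be identified by the same output.\<close>

definition identifies :: "nat \<Rightarrow> (nat \<Rightarrow> real) \<Rightarrow> nat \<Rightarrow> bool" where
  "identifies m y i \<longleftrightarrow> y i > 1/4 \<and> (\<forall>k<m. k \<noteq> i \<longrightarrow> y k < 1/4)"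

abbreviation leb :: "nat set \<Rightarrow> (nat \<Rightarrow> real) measure" where
  "leb J \<equiv> \<Pi>\<^sub>M j\<in>J. lborel"

lemma dim_ell [simp]: "dim (ell_1 m) = m" "dim (ell_infty m) = m"
  by (simp_all add: ell_1_def ell_infty_def)

lemma borel_vecs_ell: "borel_vecs (ell_infty m) = borel_vecs (ell_1 m)"
  by (simp add: borel_vecs_def)

lemma space_borel_vecs: "space (borel_vecs F) = vecs F"
  by (simp add: borel_vecs_def vecs_def space_PiM)

lemma measurable_component_vecs:
  "i < dim F \<Longrightarrow> (\<lambda>f. f i) \<in> borel_measurable (borel_vecs F)"
  unfolding borel_vecs_def by (rule measurable_component_singleton) simp

lemma box_sets [measurable]: "finite J \<Longrightarrow> box J r \<in> sets (leb J)"
  unfolding box_def by (rule sets_PiM_I_finite) auto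

lemma emeasure_box:
  assumes "finite J" "r \<ge> 0"
  shows "emeasure (leb J) (box J r) = ennreal ((2 * r) ^ card J)"
proof -
  interpret product_sigma_finite "\<lambda>_::nat. lborel :: real measure" by standard
  show ?thesis
    unfolding box_def using assms by (subst emeasure_PiM) (auto simp: ennreal_power)
qed

lemma measurable_embed [measurable]: "embed m J \<in> measurable (leb J) (borel_vecs (ell_1 m))"
proof -
  have "(\<lambda>u. if k \<in> J then u k else 0) \<in> borel_measurable (leb J)" for k
    by (cases "k \<in> J") simp_all
  then show ?thesis unfolding embed_def borel_vecs_def dim_ell by (intro measurable_restrict) simp
qed

lemma measurable_spiked [measurable]: "spiked m J i \<in> measurable (leb J) (borel_vecs (ell_1 m))"
proof -
  have "(\<lambda>u. (if k \<in> J then u k else 0) + (if k = i then 1/2 else 0)) \<in> borel_measurable (leb J)" for k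
    by (cases "k \<in> J") simp_all
  then show ?thesis unfolding spiked_def borel_vecs_def dim_ell by (intro measurable_restrict) simp
qed

lemma pred_identifies:
  assumes "i < m"
  shows "Measurable.pred (borel_vecs (ell_infty m)) (\<lambda>y. identifies m y i)"
proof -
  have [measurable]: "(\<lambda>y. y k) \<in> borel_measurable (borel_vecs (ell_infty m))" if "k < m" for k
    using that by (intro measurable_component_vecs) simp
  have "Measurable.pred (borel_vecs (ell_infty m)) (\<lambda>y. k \<noteq> i \<longrightarrow> y k < 1/4)"
    if "k \<in> {..<m}" for k
    using that by simp
  then have [measurable]: "Measurable.pred (borel_vecs (ell_infty m)) (\<lambda>y. \<forall>k\<in>{..<m}. k \<noteq> i \<longrightarrow> y k < 1/4)"
    by (intro pred_intros_finite) auto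
  have "(\<forall>k<m. k \<noteq> i \<longrightarrow> y k < 1/4) \<longleftrightarrow> (\<forall>k\<in>{..<m}. k \<noteq> i \<longrightarrow> y k < 1/4)" for y :: "nat \<Rightarrow> real"
    by auto
  then show ?thesis unfolding identifies_def using assms by simp
qed

lemma spiked_in_vecs: "spiked m J i z \<in> vecs (ell_1 m)"
  and embed_in_vecs: "embed m J z \<in> vecs (ell_1 m)"
  by (auto simp: spiked_def embed_def vecs_def)

text \<open>\<open>E i\<close> collects the pure noise in the enlarged cube from which the output
  identifies \<open>i\<close>. The shift carries the spiked noise that identifies \<open>i\<close>
  into \<open>E i\<close> without change of volume, and the sets \<open>E i\<close> are disjoint, so
  their total volume is at most that of the enlarged cube.\<close>

lemma identified_volume:
  fixes N :: "nat \<Rightarrow> (nat \<Rightarrow> real) \<Rightarrow> real" and r :: real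
  assumes c: "\<And>i k. c i k = N k (unit_vec m i)"
    and J: "J \<subseteq> {..<m}" and r: "r \<ge> 0"
    and A: "A \<in> measurable (borel_vecs (ell_1 m)) (borel_vecs (ell_infty m))"
    and N: "\<And>k. k < n \<Longrightarrow> N k \<in> dual (ell_1 m)"
    and AN: "\<And>f g. f \<in> vecs (ell_1 m) \<Longrightarrow> g \<in> vecs (ell_1 m) \<Longrightarrow> (\<And>k. k < n \<Longrightarrow> N k f = N k g) \<Longrightarrow> A f = A g"
  shows "(\<Sum>i | i \<in> {..<m} - J \<and> spanned n c J i.
      measure (leb J) {z \<in> box J r. identifies m (A (spiked m J i z)) i}) \<le> (1 + 2 * r) ^ card J"
proof -
  let ?I = "{i. i \<in> {..<m} - J \<and> spanned n c J i}"
  have fJ: "finite J" using J finite_subset by blast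
  define E where "E i = {u \<in> box J (1/2 + r). identifies m (A (embed m J u)) i}" for i
  define S where "S i = {z \<in> box J r. identifies m (A (spiked m J i z)) i}" for i
  have space: "box J q \<subseteq> space (leb J)" for q by (auto simp: box_def space_PiM)
  have E: "E i \<in> sets (leb J)" if "i < m" for i
  proof -
    have "{u \<in> space (leb J). identifies m (A (embed m J u)) i} \<in> sets (leb J)"
      using measurable_compose[OF measurable_compose[OF measurable_embed A] pred_identifies[OF that]]
      by (simp add: pred_def)
    then have "{u \<in> space (leb J). identifies m (A (embed m J u)) i} \<inter> box J (1/2 + r) \<in> sets (leb J)"
      using box_sets[OF fJ] by blast
    also have "{u \<in> space (leb J). identifies m (A (embed m J u)) i} \<inter> box J (1/2 + r) = E i"
      using space by (auto simp: E_def)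
    finally show ?thesis .
  qed
  have le: "emeasure (leb J) (S i) \<le> emeasure (leb J) (E i)" if i: "i \<in> ?I" for i
  proof -
    obtain a where a: "\<And>j. \<bar>a j\<bar> \<le> 1" "\<And>k. k < n \<Longrightarrow> c i k = (\<Sum>j\<in>J. a j * c j k)"
      using i unfolding spanned_def by blast
    let ?T = "\<lambda>u. \<lambda>j\<in>J. u j + a j / 2"
    have T: "?T \<in> measurable (leb J) (leb J)" by measurable
    \<comment> \<open>The measurements cannot tell the spike from a shift of the noise.\<close>
    have "A (spiked m J i z) = A (embed m J (?T z))" for z
    proof (rule AN)
      fix k assume k: "k < n"
      have Nk: "N k f = (\<Sum>j<m. f j * c j k)" if "f \<in> vecs (ell_1 m)" for f
        using dual_expand[OF N[OF k] that] by (simp add: c)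
      have "N k (spiked m J i z) = (\<Sum>j<m. (if j \<in> J then z j * c j k else 0) + (if j = i then c j k / 2 else 0))"
        unfolding Nk[OF spiked_in_vecs] by (rule sum.cong) (auto simp: spiked_def distrib_right)
      also have "\<dots> = (\<Sum>j\<in>J. z j * c j k) + c i k / 2"
        using i J by (simp add: sum.distrib Int_absorb1 flip: sum.inter_restrict)
      also have "\<dots> = (\<Sum>j\<in>J. ?T z j * c j k)"
        by (simp add: a(2)[OF k] sum_divide_distrib flip: sum.distrib) (simp add: distrib_right)
      also have "\<dots> = (\<Sum>j<m. (if j \<in> J then ?T z j * c j k else 0))"
        using J by (simp add: Int_absorb1 flip: sum.inter_restrict)
      also have "\<dots> = N k (embed m J (?T z))"
        unfolding Nk[OF embed_in_vecs] by (rule sum.cong) (auto simp: embed_def)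
      finally show "N k (spiked m J i z) = N k (embed m J (?T z))" .
    qed (simp_all add: spiked_in_vecs embed_in_vecs)
    moreover have "?T z \<in> box J (1/2 + r)" if z: "z \<in> box J r" for z
    proof -
      have "- (1/2 + r) \<le> z j + a j / 2 \<and> z j + a j / 2 \<le> 1/2 + r" if "j \<in> J" for j
        using a(1)[of j] z that unfolding box_def by (fastforce simp: PiE_iff)
      then show ?thesis by (auto simp: box_def)
    qed
    ultimately have "S i \<subseteq> ?T -` E i \<inter> space (leb J)"
      using space[of r] by (auto simp: S_def E_def)
    then have "emeasure (leb J) (S i) \<le> emeasure (leb J) (?T -` E i \<inter> space (leb J))"
      by (rule emeasure_mono) (use T E i in auto)
    also have "\<dots> = emeasure (distr (leb J) (leb J) ?T) (E i)"
      by (rule emeasure_distr[symmetric, OF T]) (use E i in auto)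
    also have "\<dots> = emeasure (leb J) (E i)"
      by (simp only: distr_PiM_lborel_shift[OF fJ])
    finally show ?thesis .
  qed
  have disj: "disjoint_family_on E ?I"
    unfolding disjoint_family_on_def
  proof (intro ballI impI)
    fix i j assume "i \<in> ?I" "j \<in> ?I" "i \<noteq> j"
    then show "E i \<inter> E j = {}" by (force simp: E_def identifies_def)
  qed
  have finI: "finite ?I" by simp
  have fin: "emeasure (leb J) X < \<infinity>" if "X \<subseteq> box J q" "q \<ge> 0" for X q
    using emeasure_mono[OF that(1) box_sets[OF fJ]] emeasure_box[OF fJ that(2)]
    by (auto simp: less_top[symmetric] top_unique)
  have "ennreal (\<Sum>i\<in>?I. measure (leb J) (S i)) = (\<Sum>i\<in>?I. ennreal (measure (leb J) (S i)))"
    by (rule sum_ennreal[symmetric]) simp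
  also have "\<dots> = (\<Sum>i\<in>?I. emeasure (leb J) (S i))"
    using fin[of _ r] r by (intro sum.cong emeasure_eq_ennreal_measure[symmetric] refl) (auto simp: S_def less_top)
  also have "\<dots> \<le> (\<Sum>i\<in>?I. emeasure (leb J) (E i))"
    by (rule sum_mono) (rule le)
  also have "\<dots> = emeasure (leb J) (\<Union>i\<in>?I. E i)"
    by (rule sum_emeasure[OF _ disj finI]) (use E in auto)
  also have "\<dots> \<le> emeasure (leb J) (box J (1/2 + r))"
    by (rule emeasure_mono) (use box_sets[OF fJ] in \<open>auto simp: E_def\<close>)
  also have "\<dots> = ennreal ((1 + 2 * r) ^ card J)"
    using r by (subst emeasure_box[OF fJ]) (auto simp: algebra_simps)
  finally show ?thesis using r by (simp add: S_def)
qed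

section \<open>From misidentification to the average error\<close>

definition input_error :: "nat \<Rightarrow> ((nat \<Rightarrow> real) \<Rightarrow> nat \<Rightarrow> real) \<Rightarrow> (nat \<Rightarrow> real) \<Rightarrow> real" where
  "input_error m A f = vnorm (ell_infty m) (vec_diff (ell_infty m) (A f) f)"

lemma input_error_ge:
  assumes "k < m"
  shows "input_error m A f \<ge> \<bar>A f k - f k\<bar>"
  unfolding input_error_def ell_infty_def vec_diff_def
  by (simp, rule Max_ge) (use assms in \<open>auto intro!: image_eqI[of _ _ k]\<close>)

text \<open>The failure shows either at the spike, where the output falls short by at least 1/4, or
  elsewhere, where an entry of at most 1/8 is reported as at least 1/4.\<close>

lemma input_error_ge_misidentified:
  assumes "z \<in> box J r" "r \<le> 1/8" "i < m" "i \<notin> J"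
    and "\<not> identifies m (A (spiked m J i z)) i"
  shows "input_error m A (spiked m J i z) \<ge> 1/8"
proof -
  let ?f = "spiked m J i z"
  consider "A ?f i \<le> 1/4" | k where "k < m" "k \<noteq> i" "A ?f k \<ge> 1/4"
    using assms by (force simp: identifies_def)
  then show ?thesis
  proof cases
    case 1
    moreover have "?f i = 1/2" using assms by (simp add: spiked_def)
    ultimately show ?thesis using input_error_ge[of i m A ?f] assms by linarith
  next
    case 2
    have "?f k \<le> 1/8"
      using assms 2 by (auto simp: spiked_def box_def PiE_iff intro: order_trans)
    then show ?thesis using input_error_ge[of k m A ?f] 2 by linarith
  qed
qed

lemma measurable_input_error:
  assumes "m > 0"
  shows "(\<lambda>(y, f). vnorm (ell_infty m) (vec_diff (ell_infty m) y f))
    \<in> borel_measurable (borel_vecs (ell_infty m) \<Otimes>\<^sub>M borel_vecs (ell_1 m))"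
proof -
  have 1: "(\<lambda>y. y k) \<in> borel_measurable (borel_vecs (ell_1 m))" if "k < m" for k
    using that by (intro measurable_component_vecs) simp
  have 2: "(\<lambda>p. \<bar>fst p k - snd p k\<bar>)
      \<in> borel_measurable (borel_vecs (ell_infty m) \<Otimes>\<^sub>M borel_vecs (ell_1 m))" if "k < m" for k
    using measurable_compose[OF measurable_fst 1[OF that]] measurable_compose[OF measurable_snd 1[OF that]]
    unfolding borel_vecs_ell by (intro borel_measurable_abs borel_measurable_diff)
  have "(\<lambda>p. Max ((\<lambda>k. \<bar>fst p k - snd p k\<bar>) ` {..<m}))
      \<in> borel_measurable (borel_vecs (ell_infty m) \<Otimes>\<^sub>M borel_vecs (ell_1 m))"
    by (rule borel_measurable_Max[of "{..<m}" "\<lambda>k p. \<bar>fst p k - snd p k\<bar>"]) (use 2 in auto)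
  also have "(\<lambda>p. Max ((\<lambda>k. \<bar>fst p k - snd p k\<bar>) ` {..<m}))
      = (\<lambda>(y, f). vnorm (ell_infty m) (vec_diff (ell_infty m) y f))"
    by (auto simp: fun_eq_iff ell_infty_def vec_diff_def intro!: arg_cong[where f = Max])
  finally show ?thesis .
qed

text \<open>Each misidentified input costs 1/8. Spanned pairs are identified on at most a quarter of
  the total volume, by \<open>identified_volume\<close> and the size of \<open>m\<close>; unspanned
  pairs make up at most another quarter, by \<open>card_not_spanned\<close>. The remaining half
  yields the constant 1/16.\<close>

lemma average_error_ge:
  fixes N :: "nat \<Rightarrow> (nat \<Rightarrow> real) \<Rightarrow> real" and n m s :: nat
  defines "s \<equiv> 4 * n"
  assumes n: "n > 0" and m: "real m \<ge> real s + 4 * (1 + real s) ^ s"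
    and A: "A \<in> measurable (borel_vecs (ell_1 m)) (borel_vecs (ell_infty m))"
    and N: "\<And>k. k < n \<Longrightarrow> N k \<in> dual (ell_1 m)"
    and AN: "\<And>f g. f \<in> vecs (ell_1 m) \<Longrightarrow> g \<in> vecs (ell_1 m) \<Longrightarrow> (\<And>k. k < n \<Longrightarrow> N k f = N k g) \<Longrightarrow> A f = A g"
  shows "(\<Sum>J | J \<subseteq> {..<m} \<and> card J = s. \<Sum>i\<in>{..<m} - J.
      \<integral>\<^sup>+z\<in>box J (1 / (2 * real s)). ennreal (input_error m A (spiked m J i z)) \<partial>leb J)
    \<ge> ennreal (1/16 * (real (m choose s) * (real m - real s) * (1 / s) ^ s))"
proof -
  define r where "r = 1 / (2 * real s)"
  define c where "c i k = N k (unit_vec m i)" for i k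
  define q where "q = (1 / real s) ^ s"
  define S where "S J i = {z \<in> box J r. identifies m (A (spiked m J i z)) i}" for J i
  define \<J> where "\<J> = {J. J \<subseteq> {..<m} \<and> card J = s}"
  have s: "s > 0" "s \<ge> 4" using n by (auto simp: s_def)
  then have r: "r \<ge> 0" "r \<le> 1/8" by (auto simp: r_def field_simps)
  have "real s < real m"
    using m zero_less_power[of "1 + real s" s] by linarith
  then have sm: "s < m" by simp
  have J: "J \<subseteq> {..<m}" "card J = s" "finite J" if "J \<in> \<J>" for J
    using that finite_subset[of J "{..<m}"] by (auto simp: \<J>_def)
  have fin\<J>: "finite \<J>" by (simp add: \<J>_def)
  have card\<J>: "card \<J> = m choose s"
    using n_subsets[of "{..<m}" s] by (simp add: \<J>_def)
  have q0: "q > 0" using s by (simp add: q_def)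
  have box: "measure (leb J) (box J r) = q" "emeasure (leb J) (box J r) = ennreal q" if "J \<in> \<J>" for J
    using emeasure_box[OF J(3)[OF that] r(1)] q0 J(2)[OF that]
    by (simp_all add: measure_def r_def q_def)
  have S: "S J i \<in> sets (leb J)" if "J \<in> \<J>" "i < m" for J i
  proof -
    have "{u \<in> space (leb J). identifies m (A (spiked m J i u)) i} \<in> sets (leb J)"
      using measurable_compose[OF measurable_compose[OF measurable_spiked A] pred_identifies[OF that(2)]]
      by (simp add: pred_def)
    then have "{u \<in> space (leb J). identifies m (A (spiked m J i u)) i} \<inter> box J r \<in> sets (leb J)"
      using box_sets[OF J(3)[OF that(1)]] by blast
    also have "{u \<in> space (leb J). identifies m (A (spiked m J i u)) i} \<inter> box J r = S J i"
      by (auto simp: S_def box_def space_PiM)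
    finally show ?thesis .
  qed
  have Sq: "measure (leb J) (S J i) \<le> q" if "J \<in> \<J>" "i < m" for J i
    unfolding box(1)[OF that(1), symmetric]
    by (rule measure_mono_fmeasurable)
      (use S[OF that] box_sets[OF J(3)[OF that(1)]] box(2)[OF that(1)] in
        \<open>auto simp: S_def fmeasurable_def\<close>)
  have int: "ennreal (1/8 * (q - measure (leb J) (S J i)))
      \<le> (\<integral>\<^sup>+z\<in>box J r. ennreal (input_error m A (spiked m J i z)) \<partial>leb J)"
    if "J \<in> \<J>" "i \<in> {..<m} - J" for J i
  proof -
    have i: "i < m" using that by auto
    have bs: "box J r \<in> sets (leb J)" using box_sets[OF J(3)[OF that(1)]] .
    have "measure (leb J) (box J r - S J i) = q - measure (leb J) (S J i)"
      using bs S[OF that(1) i] box[OF that(1)]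
      by (subst measure_Diff) (auto simp: S_def)
    moreover have "emeasure (leb J) (box J r - S J i) \<noteq> \<infinity>"
      using emeasure_mono[of "box J r - S J i" "box J r" "leb J"] bs box(2)[OF that(1)]
      by (auto simp: top_unique)
    ultimately have "emeasure (leb J) (box J r - S J i) = ennreal (q - measure (leb J) (S J i))"
      by (simp add: emeasure_eq_ennreal_measure)
    then have "ennreal (1/8 * (q - measure (leb J) (S J i)))
        = ennreal (1/8) * emeasure (leb J) (box J r - S J i)"
      using Sq[OF that(1) i] by (simp flip: ennreal_mult)
    also have "\<dots> = (\<integral>\<^sup>+z. ennreal (1/8) * indicator (box J r - S J i) z \<partial>leb J)"
      by (rule nn_integral_cmult_indicator[symmetric]) (use bs S[OF that(1) i] in auto)
    also have "\<dots> \<le> (\<integral>\<^sup>+z\<in>box J r. ennreal (input_error m A (spiked m J i z)) \<partial>leb J)"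
    proof (rule nn_integral_mono)
      fix z
      show "ennreal (1/8) * indicator (box J r - S J i) z
        \<le> ennreal (input_error m A (spiked m J i z)) * indicator (box J r) z"
        using input_error_ge_misidentified[of z J r i m A] r that
        by (auto simp: S_def indicator_def intro!: ennreal_leI)
    qed
    finally show ?thesis .
  qed
  \<comment> \<open>For unspanned \<open>i\<close> nothing prevents identification, and the whole
    noise volume \<open>q\<close> is conceded.\<close>
  have identified: "(\<Sum>i\<in>{..<m} - J. measure (leb J) (S J i))
      \<le> (1 + 1 / real s) ^ s + q * (\<Sum>i\<in>{..<m} - J. of_bool (\<not> spanned n c J i))" if "J \<in> \<J>" for J
  proof -
    have "(\<Sum>i\<in>{..<m} - J. measure (leb J) (S J i))
      \<le> (\<Sum>i\<in>{..<m} - J. (if spanned n c J i then measure (leb J) (S J i) else 0)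
            + q * of_bool (\<not> spanned n c J i))"
      by (rule sum_mono) (use Sq[OF that] in auto)
    also have "(\<Sum>i\<in>{..<m} - J. if spanned n c J i then measure (leb J) (S J i) else 0)
        = (\<Sum>i | i \<in> {..<m} - J \<and> spanned n c J i. measure (leb J) (S J i))"
      by (rule sum.inter_filter[symmetric]) simp
    then have "(\<Sum>i\<in>{..<m} - J. (if spanned n c J i then measure (leb J) (S J i) else 0)
            + q * of_bool (\<not> spanned n c J i)) = (\<Sum>i | i \<in> {..<m} - J \<and> spanned n c J i. measure (leb J) (S J i))
        + q * (\<Sum>i\<in>{..<m} - J. of_bool (\<not> spanned n c J i))"
      by (simp add: sum.distrib sum_distrib_left)
    also have "(\<Sum>i | i \<in> {..<m} - J \<and> spanned n c J i. measure (leb J) (S J i)) \<le> (1 + 2 * r) ^ card J"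
      unfolding S_def by (rule identified_volume[OF _ J(1)[OF that] r(1) A N AN]) (auto simp: c_def)
    finally show ?thesis using J(2)[OF that] by (simp add: r_def)
  qed
  have bad: "(\<Sum>J\<in>\<J>. \<Sum>i\<in>{..<m} - J. of_bool (\<not> spanned n c J i)) \<le> real (m choose Suc s) * real n"
  proof -
    have "(\<Sum>J\<in>\<J>. \<Sum>i\<in>{..<m} - J. of_bool (\<not> spanned n c J i))
        = (\<Sum>K | K \<subseteq> {..<m} \<and> card K = Suc s. \<Sum>i\<in>K. of_bool (\<not> spanned n c (K - {i}) i) :: real)"
      unfolding \<J>_def by (rule sum_subset_complement) simp
    also have "\<dots> \<le> (\<Sum>K | K \<subseteq> {..<m} \<and> card K = Suc s. real n)"
    proof (rule sum_mono)
      fix K assume "K \<in> {K. K \<subseteq> {..<m} \<and> card K = Suc s}"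
      then have K: "finite K" using finite_subset[of K "{..<m}"] by auto
      have "(\<Sum>i\<in>K. of_bool (\<not> spanned n c (K - {i}) i) :: real)
          = real (card {i \<in> K. \<not> spanned n c (K - {i}) i})"
        using K by (simp add: of_bool_def if_distrib Int_def flip: sum.inter_filter)
      also have "\<dots> \<le> real n" using card_not_spanned[OF K, of n c] by simp
      finally show "(\<Sum>i\<in>K. of_bool (\<not> spanned n c (K - {i}) i)) \<le> real n" .
    qed
    also have "\<dots> = real (m choose Suc s) * real n"
      using n_subsets[of "{..<m}" "Suc s"] by simp
    finally show ?thesis .
  qed
  \<comment> \<open>\<open>T\<close> is the number of pairs \<open>(J, i)\<close> with
    \<open>i\<close> outside \<open>J\<close>, so \<open>T * q\<close> is the total noise
    volume.\<close>
  define T where "T = real (m choose s) * (real m - real s)"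
  have choose: "real (m choose Suc s) * (real s + 1) = T"
  proof -
    have "(m choose Suc s) * Suc s = (m choose s) * (m - s)"
      by (metis binomial_absorb_comp binomial_absorption mult.commute)
    then have "real ((m choose Suc s) * Suc s) = real ((m choose s) * (m - s))" by simp
    then show ?thesis using sm by (simp add: T_def of_nat_diff algebra_simps)
  qed
  have "(\<Sum>J\<in>\<J>. \<Sum>i\<in>{..<m} - J. measure (leb J) (S J i))
      \<le> (\<Sum>J\<in>\<J>. (1 + 1 / real s) ^ s + q * (\<Sum>i\<in>{..<m} - J. of_bool (\<not> spanned n c J i)))"
    by (rule sum_mono) (rule identified)
  also have "\<dots> = real (m choose s) * (1 + 1 / real s) ^ s
      + q * (\<Sum>J\<in>\<J>. \<Sum>i\<in>{..<m} - J. of_bool (\<not> spanned n c J i))"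
    by (simp add: sum.distrib card\<J> sum_distrib_left)
  also have "\<dots> \<le> real (m choose s) * (1 + 1 / real s) ^ s + q * (real (m choose Suc s) * real n)"
    using bad q0 by simp
  also have "\<dots> \<le> T * q / 2"
  proof -
    \<comment> \<open>The enlarged cube is \<open>(1 + s) ^ s\<close> times as large as the noise
      cube, which by the bound on \<open>m\<close> is at most a quarter of the number
      \<open>m - s\<close> of candidates for \<open>i\<close>.\<close>
    have "(1 + 1 / real s) ^ s = (1 + real s) ^ s * q"
      using s by (simp add: q_def field_simps flip: power_mult_distrib)
    also have "\<dots> \<le> (real m - real s) / 4 * q"
      using m q0 by (intro mult_right_mono) auto
    finally have 1: "real (m choose s) * (1 + 1 / real s) ^ s \<le> T * q / 4"
      using mult_left_mono[of _ _ "real (m choose s)"] by (fastforce simp: T_def mult.assoc)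
    \<comment> \<open>Here the choice \<open>s = 4 * n\<close> enters: among \<open>s + 1\<close>
      columns at most a quarter are unspanned.\<close>
    have "real (m choose Suc s) * real n \<le> real (m choose Suc s) * ((real s + 1) / 4)"
      by (intro mult_left_mono) (auto simp: s_def)
    also have "\<dots> = T / 4" using choose by simp
    finally have "q * (real (m choose Suc s) * real n) \<le> T * q / 4"
      using q0 mult_left_mono[of _ "T / 4" q] by (simp add: mult.commute)
    with 1 show ?thesis by simp
  qed
  finally have sumS: "(\<Sum>J\<in>\<J>. \<Sum>i\<in>{..<m} - J. measure (leb J) (S J i)) \<le> T * q / 2" .
  have "(\<Sum>J\<in>\<J>. \<Sum>i\<in>{..<m} - J. q) = T * q"
  proof -
    have "(\<Sum>J\<in>\<J>. \<Sum>i\<in>{..<m} - J. q) = (\<Sum>J\<in>\<J>. (real m - real s) * q)"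
    proof (rule sum.cong[OF refl])
      fix K assume "K \<in> \<J>"
      then have "card ({..<m} - K) = m - s" using J[of K] by (simp add: card_Diff_subset)
      then show "(\<Sum>i\<in>{..<m} - K. q) = (real m - real s) * q" using sm by (simp add: of_nat_diff)
    qed
    then show ?thesis by (simp add: card\<J> T_def)
  qed
  then have "1/16 * (T * q) \<le> (\<Sum>J\<in>\<J>. \<Sum>i\<in>{..<m} - J. 1/8 * (q - measure (leb J) (S J i)))"
    using sumS by (simp add: sum_subtractf flip: sum_distrib_left sum_divide_distrib)
  then have "ennreal (1/16 * (T * q))
      \<le> ennreal (\<Sum>J\<in>\<J>. \<Sum>i\<in>{..<m} - J. 1/8 * (q - measure (leb J) (S J i)))"
    by (rule ennreal_leI)
  also have "\<dots> = (\<Sum>J\<in>\<J>. \<Sum>i\<in>{..<m} - J. ennreal (1/8 * (q - measure (leb J) (S J i))))"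
  proof -
    have nn: "0 \<le> 1/8 * (q - measure (leb J) (S J i))" if "J \<in> \<J>" "i \<in> {..<m} - J" for J i
      using Sq that by simp
    have "(\<Sum>J\<in>\<J>. \<Sum>i\<in>{..<m} - J. ennreal (1/8 * (q - measure (leb J) (S J i))))
        = (\<Sum>J\<in>\<J>. ennreal (\<Sum>i\<in>{..<m} - J. 1/8 * (q - measure (leb J) (S J i))))"
      by (intro sum.cong refl sum_ennreal nn)
    also have "\<dots> = ennreal (\<Sum>J\<in>\<J>. \<Sum>i\<in>{..<m} - J. 1/8 * (q - measure (leb J) (S J i)))"
      by (intro sum_ennreal sum_nonneg nn)
    finally show ?thesis ..
  qed
  also have "\<dots> \<le> (\<Sum>J\<in>\<J>. \<Sum>i\<in>{..<m} - J.
      \<integral>\<^sup>+z\<in>box J r. ennreal (input_error m A (spiked m J i z)) \<partial>leb J)"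
    by (intro sum_mono int)
  finally show ?thesis by (simp add: \<J>_def r_def T_def q_def)
qed

section \<open>Random functionals and the worst input\<close>

text \<open>A history of zeros of the right length stands for every history, which turns the rule
  \<open>L \<omega>\<close> into the fixed functionals that \<open>average_error_ge\<close>
  expects.\<close>

lemma info_nonadaptive:
  assumes na: "nonadaptive n F M L" and \<omega>: "\<omega> \<in> space M"
    and fg: "f \<in> vecs F" "g \<in> vecs F"
    and eq: "\<And>k. k < n \<Longrightarrow> L \<omega> (replicate k 0) f = L \<omega> (replicate k 0) g"
  shows "info n (L \<omega>) f = info n (L \<omega>) g"
proof -
  have len: "length (info k l h) = k" for k l h by (induction k) auto
  have "info k (L \<omega>) f = info k (L \<omega>) g" if "k \<le> n" for k
    using that
  proof (induction k)
    case (Suc k)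
    have "L \<omega> (info k (L \<omega>) f) h = L \<omega> (replicate k 0) h" if "h \<in> vecs F" for h
      using na \<omega> Suc.prems that len unfolding nonadaptive_def
      by (metis Suc_le_lessD length_replicate)
    then show ?case using Suc eq[of k] fg by simp
  qed simp
  then show ?thesis by simp
qed

text \<open>The worst input is at least as bad as the average over \<open>J\<close>,
  \<open>i\<close> and the noise. Exchanging this average with the expectation reduces the claim to
  a fixed \<open>\<omega>\<close>, that is, to \<open>average_error_ge\<close>.\<close>

theorem e_ran_nonada_ge:
  fixes n m s :: nat
  defines "s \<equiv> 4 * n"
  assumes n: "n > 0" and m: "real m \<ge> real s + 4 * (1 + real s) ^ s"
  shows "e_ran_nonada n (ell_1 m) (ell_infty m) (\<lambda>x. x) \<ge> ennreal (1/16)"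
  unfolding e_ran_nonada_def
proof (rule Inf_greatest)
  fix e assume "e \<in> {mc_error n (ell_1 m) (ell_infty m) (\<lambda>x. x) M L \<phi> | (M :: real measure) L \<phi>.
            randomized_alg n (ell_1 m) (ell_infty m) M L \<phi> \<and> nonadaptive n (ell_1 m) M L}"
  then obtain M :: "real measure" and L \<phi> where e: "e = mc_error n (ell_1 m) (ell_infty m) (\<lambda>x. x) M L \<phi>"
    and alg: "randomized_alg n (ell_1 m) (ell_infty m) M L \<phi>" and na: "nonadaptive n (ell_1 m) M L"
    by blast
  interpret prob_space M using alg by (simp add: randomized_alg_def)
  define A where "A = alg_out n L \<phi>"
  define q where "q = (1 / real s) ^ s"
  define r where "r = 1 / (2 * real s)"
  define \<J> where "\<J> = {J. J \<subseteq> {..<m} \<and> card J = s}"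
  have s: "s > 0" using n by (simp add: s_def)
  then have r: "r \<ge> 0" by (simp add: r_def)
  have "real s < real m"
    using m zero_less_power[of "1 + real s" s] by linarith
  then have sm: "s < m" by simp
  have J: "J \<subseteq> {..<m}" "card J = s" "finite J" if "J \<in> \<J>" for J
    using that finite_subset[of J "{..<m}"] by (auto simp: \<J>_def)
  have card\<J>: "card \<J> = m choose s"
    using n_subsets[of "{..<m}" s] by (simp add: \<J>_def)
  have q0: "q > 0" using s by (simp add: q_def)
  define T where "T = real (m choose s) * (real m - real s)"
  have T: "T > 0" using sm by (simp add: T_def)
  have Am: "(\<lambda>(\<omega>, f). A \<omega> f) \<in> measurable (M \<Otimes>\<^sub>M borel_vecs (ell_1 m)) (borel_vecs (ell_infty m))"
    using alg by (simp add: randomized_alg_def A_def)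
  have lower: "ennreal (1/16 * (T * q)) \<le> (\<Sum>J\<in>\<J>. \<Sum>i\<in>{..<m} - J.
      \<integral>\<^sup>+z\<in>box J r. ennreal (input_error m (A \<omega>) (spiked m J i z)) \<partial>leb J)"
    if \<omega>: "\<omega> \<in> space M" for \<omega>
  proof -
    have "A \<omega> \<in> measurable (borel_vecs (ell_1 m)) (borel_vecs (ell_infty m))"
      using measurable_compose[OF measurable_Pair1'[OF \<omega>] Am] by simp
    moreover have "L \<omega> (replicate k 0) \<in> dual (ell_1 m)" if "k < n" for k
      using alg \<omega> that by (simp add: randomized_alg_def)
    moreover have "A \<omega> f = A \<omega> g" if "f \<in> vecs (ell_1 m)" "g \<in> vecs (ell_1 m)"
      "\<And>k. k < n \<Longrightarrow> L \<omega> (replicate k 0) f = L \<omega> (replicate k 0) g" for f g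
      using info_nonadaptive[OF na \<omega> that] by (simp add: A_def alg_out_def)
    ultimately show ?thesis
      using average_error_ge[OF n m[unfolded s_def], of "A \<omega>" "\<lambda>k. L \<omega> (replicate k 0)"]
      unfolding \<J>_def T_def q_def r_def s_def by blast
  qed
  define err where "err J i \<omega> z = ennreal (input_error m (A \<omega>) (spiked m J i z)) * indicator (box J r) z"
    for J i \<omega> z
  have err: "(\<lambda>(\<omega>, z). err J i \<omega> z) \<in> borel_measurable (M \<Otimes>\<^sub>M leb J)" if "J \<in> \<J>" for J i
  proof -
    have 1: "(\<lambda>p. spiked m J i (snd p)) \<in> measurable (M \<Otimes>\<^sub>M leb J) (borel_vecs (ell_1 m))"
      by (rule measurable_compose[OF measurable_snd measurable_spiked])
    have 2: "(\<lambda>p. A (fst p) (spiked m J i (snd p))) \<in> measurable (M \<Otimes>\<^sub>M leb J) (borel_vecs (ell_infty m))"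
      using measurable_compose[OF measurable_Pair[OF measurable_fst 1] Am] by simp
    have "(\<lambda>p. input_error m (A (fst p)) (spiked m J i (snd p))) \<in> borel_measurable (M \<Otimes>\<^sub>M leb J)"
      using measurable_compose[OF measurable_Pair[OF 2 1] measurable_input_error[of m]] sm
      by (simp add: input_error_def)
    moreover have "(\<lambda>p. indicator (box J r) (snd p) :: ennreal) \<in> borel_measurable (M \<Otimes>\<^sub>M leb J)"
      using box_sets[OF J(3)[OF that]] by measurable
    ultimately have "(\<lambda>p. ennreal (input_error m (A (fst p)) (spiked m J i (snd p))) * indicator (box J r) (snd p))
        \<in> borel_measurable (M \<Otimes>\<^sub>M leb J)" by measurable
    then show ?thesis by (simp add: err_def case_prod_beta)
  qed
  have sf: "sigma_finite_measure (leb J)" if "J \<in> \<J>" for J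
  proof -
    interpret product_sigma_finite "\<lambda>_::nat. lborel :: real measure" by standard
    show ?thesis by (rule sigma_finite[OF J(3)[OF that]])
  qed
  \<comment> \<open>All spiked inputs lie in the unit ball, so their expected error is at most
    \<open>e\<close>; integration over the noise cube contributes its volume
    \<open>q\<close>.\<close>
  have upper: "(\<integral>\<^sup>+\<omega>. (\<integral>\<^sup>+z. err J i \<omega> z \<partial>leb J) \<partial>M) \<le> e * ennreal q"
    if J': "J \<in> \<J>" and i: "i \<in> {..<m} - J" for J i
  proof -
    interpret LJ: sigma_finite_measure "leb J" by (rule sf[OF J'])
    interpret P: pair_sigma_finite M "leb J" by standard
    have "(\<integral>\<^sup>+\<omega>. (\<integral>\<^sup>+z. err J i \<omega> z \<partial>leb J) \<partial>M) = (\<integral>\<^sup>+z. (\<integral>\<^sup>+\<omega>. err J i \<omega> z \<partial>M) \<partial>leb J)"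
      by (rule P.Fubini'[symmetric, OF err[OF J']])
    also have "\<dots> \<le> (\<integral>\<^sup>+z. e * indicator (box J r) z \<partial>leb J)"
    proof (rule nn_integral_mono)
      fix z
      show "(\<integral>\<^sup>+\<omega>. err J i \<omega> z \<partial>M) \<le> e * indicator (box J r) z"
      proof (cases "z \<in> box J r")
        case True
        have "vnorm (ell_1 m) (spiked m J i z) = (\<Sum>k<m. (if k \<in> J then \<bar>z k\<bar> else 0) + (if k = i then 1/2 else 0))"
          using i by (auto simp: ell_1_def spiked_def intro!: sum.cong)
        also have "\<dots> = (\<Sum>k\<in>J. \<bar>z k\<bar>) + 1/2"
          using i J(1)[OF J'] by (simp add: sum.distrib Int_absorb1 flip: sum.inter_restrict)
        also have "(\<Sum>k\<in>J. \<bar>z k\<bar>) \<le> (\<Sum>k\<in>J. r)"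
          using True by (intro sum_mono) (auto simp: box_def PiE_iff)
        also have "(\<Sum>k\<in>J. r) = 1/2" using J(2)[OF J'] s by (simp add: r_def)
        finally have "spiked m J i z \<in> {f \<in> vecs (ell_1 m). vnorm (ell_1 m) f \<le> 1}"
          using spiked_in_vecs by simp
        then have "(\<integral>\<^sup>+\<omega>. ennreal (input_error m (A \<omega>) (spiked m J i z)) \<partial>M) \<le> e"
          unfolding e mc_error_def input_error_def A_def by (rule SUP_upper)
        then show ?thesis using True by (simp add: err_def)
      qed (simp add: err_def)
    qed
    also have "\<dots> = e * emeasure (leb J) (box J r)"
      using box_sets[OF J(3)[OF J']] by (rule nn_integral_cmult_indicator)
    also have "emeasure (leb J) (box J r) = ennreal q"
      using emeasure_box[OF J(3)[OF J'] r] J(2)[OF J'] by (simp add: r_def q_def)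
    finally show ?thesis .
  qed
  have meas: "(\<lambda>\<omega>. \<integral>\<^sup>+z. err J i \<omega> z \<partial>leb J) \<in> borel_measurable M" if "J \<in> \<J>" for J i
  proof -
    interpret LJ: sigma_finite_measure "leb J" by (rule sf[OF that])
    show ?thesis using LJ.borel_measurable_nn_integral[OF err[OF that]] .
  qed
  have "ennreal (1/16 * (T * q)) = (\<integral>\<^sup>+\<omega>. ennreal (1/16 * (T * q)) \<partial>M)"
    by (simp add: emeasure_space_1)
  also have "\<dots> \<le> (\<integral>\<^sup>+\<omega>. (\<Sum>J\<in>\<J>. \<Sum>i\<in>{..<m} - J. \<integral>\<^sup>+z. err J i \<omega> z \<partial>leb J) \<partial>M)"
    by (rule nn_integral_mono) (use lower in \<open>simp add: err_def\<close>)
  also have "\<dots> = (\<Sum>J\<in>\<J>. \<Sum>i\<in>{..<m} - J. \<integral>\<^sup>+\<omega>. (\<integral>\<^sup>+z. err J i \<omega> z \<partial>leb J) \<partial>M)"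
  proof -
    have "(\<integral>\<^sup>+\<omega>. (\<Sum>J\<in>\<J>. \<Sum>i\<in>{..<m} - J. \<integral>\<^sup>+z. err J i \<omega> z \<partial>leb J) \<partial>M)
        = (\<Sum>J\<in>\<J>. \<integral>\<^sup>+\<omega>. (\<Sum>i\<in>{..<m} - J. \<integral>\<^sup>+z. err J i \<omega> z \<partial>leb J) \<partial>M)"
      by (intro nn_integral_sum borel_measurable_sum meas)
    also have "\<dots> = (\<Sum>J\<in>\<J>. \<Sum>i\<in>{..<m} - J. \<integral>\<^sup>+\<omega>. (\<integral>\<^sup>+z. err J i \<omega> z \<partial>leb J) \<partial>M)"
      by (intro sum.cong refl nn_integral_sum meas)
    finally show ?thesis .
  qed
  also have "\<dots> \<le> (\<Sum>J\<in>\<J>. \<Sum>i\<in>{..<m} - J. e * ennreal q)"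
    by (intro sum_mono upper)
  also have "\<dots> = (\<Sum>J\<in>\<J>. of_nat (m - s) * (e * ennreal q))"
  proof (rule sum.cong[OF refl])
    fix K assume "K \<in> \<J>"
    then have "card ({..<m} - K) = m - s" using J[of K] by (simp add: card_Diff_subset)
    then show "(\<Sum>i\<in>{..<m} - K. e * ennreal q) = of_nat (m - s) * (e * ennreal q)" by simp
  qed
  also have "\<dots> = ennreal (T * q) * e"
  proof -
    have "ennreal (T * q) = ennreal (real (m choose s)) * ennreal (real (m - s)) * ennreal q"
      using sm q0 by (simp add: T_def of_nat_diff ennreal_mult)
    then show ?thesis by (simp add: card\<J> ennreal_of_nat_eq_real_of_nat mult_ac)
  qed
  finally have "ennreal (T * q) * ennreal (1/16) \<le> ennreal (T * q) * e"
    using T q0 by (simp add: mult.commute flip: ennreal_mult)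
  \<comment> \<open>The factor \<open>T * q\<close> is nonzero and finite, so it cancels even if
    \<open>e\<close> is infinite.\<close>
  then show "ennreal (1/16) \<le> e"
    using T q0 by (subst (asm) ennreal_mult_le_mult_iff) auto
qed

section \<open>Functions computable from adaptive measurements\<close>

text \<open>An adaptive method as a decision tree: once the value \<open>y\<close> of the first
  functional is known, \<open>K y\<close> describes the rest. Such trees compose more easily than
  measurement rules.\<close>

primrec computable :: "nat \<Rightarrow> coord_space \<Rightarrow> ((nat \<Rightarrow> real) \<Rightarrow> 'o) \<Rightarrow> bool" where
  "computable 0 F A \<longleftrightarrow> (\<exists>c. \<forall>f\<in>vecs F. A f = c)"
| "computable (Suc n) F A \<longleftrightarrow>
     (\<exists>l\<in>dual F. \<exists>K. (\<forall>y. computable n F (K y)) \<and> (\<forall>f\<in>vecs F. A f = K (l f) f))"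

lemma zero_in_dual: "(\<lambda>f. 0) \<in> dual F"
  by (auto simp: dual_def intro: exI[of _ 0])

lemma computable_cong:
  assumes "computable n F A" "\<And>f. f \<in> vecs F \<Longrightarrow> B f = A f"
  shows "computable n F B"
  using assms by (cases n) fastforce+

lemma computable_const: "computable n F (\<lambda>f. c)"
proof (induction n)
  case (Suc n)
  then show ?case by (auto intro!: bexI[OF _ zero_in_dual] exI[of _ "\<lambda>y f. c"])
qed auto

text \<open>The second stage may depend on the result of the first, so the measurements of an
  adaptive method can be counted stage by stage.\<close>

lemma computable_bind:
  assumes "computable n F A" "\<And>a. computable n' F (B a)"
  shows "computable (n + n') F (\<lambda>f. B (A f) f)"
  using assms
proof (induction n arbitrary: A)
  case 0
  then obtain c where "\<forall>f\<in>vecs F. A f = c" by auto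
  then show ?case using computable_cong[OF 0(2)[of c]] by simp
next
  case (Suc n)
  from Suc.prems(1) obtain l K where l: "l \<in> dual F" "\<And>y. computable n F (K y)" "\<And>f. f \<in> vecs F \<Longrightarrow> A f = K (l f) f"
    unfolding computable.simps by blast
  have "computable (n + n') F (\<lambda>f. B (K y f) f)" for y
    using Suc.IH[OF l(2) Suc.prems(2)] .
  then have "\<exists>K'. (\<forall>y. computable (n + n') F (K' y)) \<and> (\<forall>f\<in>vecs F. B (A f) f = K' (l f) f)"
    using l(3) by (intro exI[of _ "\<lambda>y f. B (K y f) f"]) simp
  then show ?case using l(1) by auto
qed

lemma computable_map: "computable n F A \<Longrightarrow> computable n F (\<lambda>f. h (A f))"
  using computable_bind[of n F A 0 "\<lambda>a f. h a"] by simp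

lemma computable_mono: "computable n F A \<Longrightarrow> n \<le> n' \<Longrightarrow> computable n' F A"
  using computable_bind[of n F A "n' - n" "\<lambda>a f. a", OF _ computable_const] by simp

lemma computable_functional: "l \<in> dual F \<Longrightarrow> computable 1 F l"
  by (auto intro!: exI[of _ "\<lambda>y f. y"])

lemma computable_map_list:
  assumes "\<And>x. computable c F (B x)"
  shows "computable (c * length xs) F (\<lambda>f. map (\<lambda>x. B x f) xs)"
proof (induction xs)
  case (Cons x xs)
  have "computable (c + c * length xs) F (\<lambda>f. (\<lambda>y f. y # map (\<lambda>x. B x f) xs) (B x f) f)"
    by (rule computable_bind[OF assms]) (rule computable_map[OF Cons])
  then show ?case by simp
qed simp

text \<open>\<open>info\<close> grows at its end, whereas decision trees branch at the root.\<close>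

lemma info_Suc_Cons: "info (Suc n) L f = L [] f # info n (\<lambda>ys. L (L [] f # ys)) f"
  by (induction n) simp_all

text \<open>For a nonempty history, the rule passes to the subtree chosen by the first value and
  hands the remaining values to it.\<close>

lemma computable_info:
  assumes "computable n F A"
  shows "\<exists>L \<phi>. (\<forall>ys. length ys < n \<longrightarrow> L ys \<in> dual F) \<and> (\<forall>f\<in>vecs F. \<phi> (info n L f) = A f)"
  using assms
proof (induction n arbitrary: A)
  case 0
  then obtain c where "\<forall>f\<in>vecs F. A f = c" by auto
  then show ?case by (intro exI[of _ "\<lambda>_. c"] exI[of _ "\<lambda>_ _. 0"]) simp
next
  case (Suc n)
  from Suc.prems(1) obtain l K where l: "l \<in> dual F" "\<And>y. computable n F (K y)" "\<And>f. f \<in> vecs F \<Longrightarrow> A f = K (l f) f"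
    unfolding computable.simps by blast
  from Suc.IH[OF l(2)] obtain L \<phi> where L: "\<And>y ys. length ys < n \<Longrightarrow> L y ys \<in> dual F"
    "\<And>y f. f \<in> vecs F \<Longrightarrow> \<phi> y (info n (L y) f) = K y f" by metis
  define L' where "L' ys = (case ys of [] \<Rightarrow> l | y # zs \<Rightarrow> L y zs)" for ys
  define \<phi>' where "\<phi>' ys = \<phi> (hd ys) (tl ys)" for ys
  have "L' ys \<in> dual F" if "length ys < Suc n" for ys
    using that l(1) L(1) by (auto simp: L'_def split: list.splits)
  moreover have "\<phi>' (info (Suc n) L' f) = A f" if "f \<in> vecs F" for f
    unfolding info_Suc_Cons using that by (simp add: \<phi>'_def L'_def L(2) l(3))
  ultimately show ?case by blast
qed

lemma weighted_sum_in_dual: "(\<lambda>f. \<Sum>i<m. w i * f i) \<in> dual (ell_1 m)"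
proof -
  have "\<bar>\<Sum>i<m. w i * f i\<bar> \<le> (\<Sum>i<m. \<bar>w i\<bar>) * (\<Sum>i<m. \<bar>f i\<bar>)" for f :: "nat \<Rightarrow> real"
  proof -
    have "\<bar>\<Sum>i<m. w i * f i\<bar> \<le> (\<Sum>i<m. \<bar>w i\<bar> * \<bar>f i\<bar>)"
      by (rule order_trans[OF sum_abs]) (simp add: abs_mult)
    also have "\<dots> \<le> (\<Sum>i<m. \<bar>w i\<bar> * (\<Sum>i<m. \<bar>f i\<bar>))"
      by (intro sum_mono mult_left_mono member_le_sum) auto
    finally show ?thesis by (simp add: sum_distrib_right)
  qed
  then have "\<exists>K. \<forall>x\<in>vecs (ell_1 m). \<bar>\<Sum>i<m. w i * x i\<bar> \<le> K * vnorm (ell_1 m) x"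
    by (intro exI[of _ "\<Sum>i<m. \<bar>w i\<bar>"]) (simp add: ell_1_def)
  moreover have "(\<Sum>i<m. w i * (\<lambda>i\<in>{..<m}. a * x i + b * y i) i)
      = a * (\<Sum>i<m. w i * x i) + b * (\<Sum>i<m. w i * y i)" for x y :: "nat \<Rightarrow> real" and a b
    by (simp add: sum_distrib_left algebra_simps flip: sum.distrib)
  ultimately show ?thesis unfolding dual_def dim_ell by blast
qed

lemma computable_subset_sum: "computable 1 (ell_1 m) (\<lambda>f. \<Sum>j | j < m \<and> P j. w j * f j)"
proof -
  have "(\<Sum>j | j < m \<and> P j. w j * f j) = (\<Sum>j<m. (if P j then w j else 0) * f j)" for f
    by (rule sum.mono_neutral_cong_left) auto
  then show ?thesis
    using computable_functional[OF weighted_sum_in_dual[of "\<lambda>j. if P j then w j else 0" m]] by simp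
qed

section \<open>Finitely many equally likely methods\<close>

text \<open>With the uniform distribution on a finite set, expectations become sums and joint
  measurability reduces to measurability for each outcome.\<close>

lemma e_ran_ada_le:
  fixes \<Omega> :: "'w set" and A :: "'w \<Rightarrow> (nat \<Rightarrow> real) \<Rightarrow> nat \<Rightarrow> real"
  assumes m: "m > 0" and fin: "finite \<Omega>" "\<Omega> \<noteq> {}"
    and comp: "\<And>\<omega>. \<omega> \<in> \<Omega> \<Longrightarrow> computable n (ell_1 m) (A \<omega>)"
    and meas: "\<And>\<omega>. \<omega> \<in> \<Omega> \<Longrightarrow> A \<omega> \<in> measurable (borel_vecs (ell_1 m)) (borel_vecs (ell_infty m))"
    and err: "\<And>f. f \<in> vecs (ell_1 m) \<Longrightarrow> vnorm (ell_1 m) f \<le> 1 \<Longrightarrow>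
      (\<Sum>\<omega>\<in>\<Omega>. input_error m (A \<omega>) f) \<le> real (card \<Omega>) * \<delta>"
  shows "e_ran_ada n (ell_1 m) (ell_infty m) (\<lambda>x. x) \<le> ennreal \<delta>"
proof -
  let ?F = "ell_1 m" and ?G = "ell_infty m"
  obtain L \<phi> where L: "\<And>\<omega> ys. \<omega> \<in> \<Omega> \<Longrightarrow> length ys < n \<Longrightarrow> L \<omega> ys \<in> dual ?F"
    and \<phi>: "\<And>\<omega> f. \<omega> \<in> \<Omega> \<Longrightarrow> f \<in> vecs ?F \<Longrightarrow> \<phi> \<omega> (info n (L \<omega>) f) = A \<omega> f"
    using computable_info[OF comp] by metis
  define M where "M = uniform_count_measure \<Omega>"
  have sp: "space M = \<Omega>" by (simp add: M_def space_uniform_count_measure)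
  have out: "alg_out n L \<phi> \<omega> f = A \<omega> f" if "\<omega> \<in> \<Omega>" "f \<in> vecs ?F" for \<omega> f
    using \<phi> that by (simp add: alg_out_def)
  have alg: "randomized_alg n ?F ?G M L \<phi>"
    unfolding randomized_alg_def
  proof (intro conjI ballI allI impI)
    show "prob_space M" unfolding M_def by (rule prob_space_uniform_count_measure[OF fin])
    show "L \<omega> ys \<in> dual ?F" if "\<omega> \<in> space M" "length ys < n" for \<omega> ys
      using L that sp by simp
    have "(\<lambda>(\<omega>, f). A \<omega> f) \<in> measurable (count_space \<Omega> \<Otimes>\<^sub>M borel_vecs ?F) (borel_vecs ?G)"
      by (rule measurable_pair_measure_countable1) (use fin meas in \<open>auto intro: countable_finite\<close>)
    moreover have "sets (M \<Otimes>\<^sub>M borel_vecs ?F) = sets (count_space \<Omega> \<Otimes>\<^sub>M borel_vecs ?F)"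
      by (rule sets_pair_measure_cong) (simp_all add: M_def sets_uniform_count_measure)
    ultimately have "(\<lambda>(\<omega>, f). A \<omega> f) \<in> measurable (M \<Otimes>\<^sub>M borel_vecs ?F) (borel_vecs ?G)"
      using measurable_cong_sets[OF _ refl] by blast
    then show "(\<lambda>(\<omega>, f). alg_out n L \<phi> \<omega> f) \<in> measurable (M \<Otimes>\<^sub>M borel_vecs ?F) (borel_vecs ?G)"
      by (subst measurable_cong[where g = "\<lambda>(\<omega>, f). A \<omega> f"])
        (auto simp: space_pair_measure sp space_borel_vecs out)
  qed
  have norm: "vnorm ?G \<in> borel_measurable (borel_vecs ?G)"
  proof -
    have 1: "(\<lambda>y. y k) \<in> borel_measurable (borel_vecs ?G)" if "k < m" for k
      using that by (intro measurable_component_vecs) simp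
    have 2: "(\<lambda>y. \<bar>y k\<bar>) \<in> borel_measurable (borel_vecs ?G)" if "k < m" for k
      using 1[OF that] by (rule borel_measurable_abs)
    have "vnorm ?G = (\<lambda>y. Max ((\<lambda>k. \<bar>y k\<bar>) ` {..<m}))" by (simp add: ell_infty_def)
    then show ?thesis
      using borel_measurable_Max[of "{..<m}" "\<lambda>k y. \<bar>y k\<bar>" "borel_vecs ?G"] 2 m by simp
  qed
  \<comment> \<open>\<open>e_ran_ada\<close> ranges over sample spaces of real numbers, so the
    finite space is replaced by one of these.\<close>
  obtain M' :: "real measure" and L' \<phi>' where
    "randomized_alg n ?F ?G M' L' \<phi>'"
    "mc_error n ?F ?G (\<lambda>x. x) M' L' \<phi>' = mc_error n ?F ?G (\<lambda>x. x) M L \<phi>"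
    by (rule sample_space_real[OF alg norm, where S = "\<lambda>x. x"])
  then have "e_ran_ada n ?F ?G (\<lambda>x. x) \<le> mc_error n ?F ?G (\<lambda>x. x) M L \<phi>"
    unfolding e_ran_ada_def by (intro Inf_lower CollectI exI[of _ M'] exI[of _ L'] exI[of _ \<phi>']) simp
  also have "\<dots> \<le> ennreal \<delta>"
    unfolding mc_error_def
  proof (rule SUP_least)
    fix f assume "f \<in> {f \<in> vecs ?F. vnorm ?F f \<le> 1}"
    then have f: "f \<in> vecs ?F" "vnorm ?F f \<le> 1" by auto
    have ie: "input_error m (A \<omega>) f \<ge> 0" for \<omega>
      using input_error_ge[OF m, of "A \<omega>" f] by linarith
    have "(\<integral>\<^sup>+ \<omega>. ennreal (vnorm ?G (vec_diff ?G (alg_out n L \<phi> \<omega> f) f)) \<partial>M)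
        = (\<Sum>\<omega>\<in>\<Omega>. ennreal (1 / card \<Omega>) * ennreal (input_error m (A \<omega>) f))"
      unfolding M_def uniform_count_measure_def
      by (subst nn_integral_point_measure_finite[OF fin(1)])
        (auto intro!: sum.cong simp: input_error_def out[OF _ f(1)])
    also have "\<dots> = ennreal ((\<Sum>\<omega>\<in>\<Omega>. input_error m (A \<omega>) f) / card \<Omega>)"
      using ie by (simp add: sum_divide_distrib flip: ennreal_mult sum_ennreal)
    also have "\<dots> \<le> ennreal \<delta>"
      using err[OF f] fin by (intro ennreal_leI) (simp add: divide_le_eq card_gt_0_iff mult.commute)
    finally show "(\<integral>\<^sup>+ \<omega>. ennreal (vnorm ?G (vec_diff ?G (alg_out n L \<phi> \<omega> f) f)) \<partial>M) \<le> ennreal \<delta>" .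
  qed
  finally show ?thesis .
qed

section \<open>Random hashing\<close>

text \<open>The values of a uniformly random function at \<open>i\<close> and \<open>j\<close> are
  independent, and each has a uniform image under \<open>c\<close>, so the collision probability is
  \<open>1 / card Z\<close>. In the applications \<open>c\<close> reduces hash values modulo a
  number of cells, or is the identity.\<close>

lemma card_collisions:
  fixes c :: "'b \<Rightarrow> 'c"
  assumes fin: "finite X" "finite Y" "finite Z" and ij: "i \<in> X" "j \<in> X" "i \<noteq> j"
    and c: "\<And>y. y \<in> Y \<Longrightarrow> c y \<in> Z"
    and unif: "\<And>z. z \<in> Z \<Longrightarrow> card {y \<in> Y. c y = z} * card Z = card Y"
  shows "card {H \<in> X \<rightarrow>\<^sub>E Y. c (H i) = c (H j)} * card Z = card (X \<rightarrow>\<^sub>E Y)"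
proof -
  define W where "W z = {y \<in> Y. c y = z}" for z
  define P where "P z = (\<Pi>\<^sub>E l\<in>X. if l = i \<or> l = j then W z else Y)" for z
  have P_iff: "H \<in> P z \<longleftrightarrow> H \<in> X \<rightarrow>\<^sub>E Y \<and> c (H i) = z \<and> c (H j) = z" for H z
    unfolding P_def PiE_iff W_def using ij by auto
  have "{H \<in> X \<rightarrow>\<^sub>E Y. c (H i) = c (H j)} = (\<Union>z\<in>Z. P z)"
  proof (intro set_eqI iffI)
    fix H assume H: "H \<in> {H \<in> X \<rightarrow>\<^sub>E Y. c (H i) = c (H j)}"
    then have "H \<in> P (c (H i))" by (simp add: P_iff)
    moreover have "c (H i) \<in> Z" using H c ij by (auto simp: PiE_iff)
    ultimately show "H \<in> (\<Union>z\<in>Z. P z)" by blast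
  qed (simp add: P_iff)
  moreover have "card (\<Union>z\<in>Z. P z) = (\<Sum>z\<in>Z. card (P z))"
  proof (rule card_UN_disjoint)
    show "\<forall>z\<in>Z. finite (P z)" using fin by (auto simp: P_def W_def intro!: finite_PiE)
    show "\<forall>z\<in>Z. \<forall>z'\<in>Z. z \<noteq> z' \<longrightarrow> P z \<inter> P z' = {}"
      by (auto simp: P_iff)
  qed (use fin in auto)
  moreover have "card (P z) * (card Z * card Z) = card (X \<rightarrow>\<^sub>E Y)" if "z \<in> Z" for z
  proof -
    have X: "X = insert i (insert j (X - {i, j}))" using ij by auto
    have "card (P z) = (\<Prod>l\<in>X. card (if l = i \<or> l = j then W z else Y))"
      unfolding P_def using fin by (intro card_PiE) auto
    also have "\<dots> = card (W z) * (card (W z) * (\<Prod>l\<in>X - {i, j}. card (if l = i \<or> l = j then W z else Y)))"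
      by (subst X) (use fin ij in simp)
    also have "(\<Prod>l\<in>X - {i, j}. card (if l = i \<or> l = j then W z else Y)) = card Y ^ card (X - {i, j})"
      by simp
    finally have "card (P z) * (card Z * card Z)
        = (card (W z) * card Z) * (card (W z) * card Z) * card Y ^ card (X - {i, j})"
      by simp
    also have "\<dots> = card Y * card Y * card Y ^ card (X - {i, j})"
      using unif[OF that] by (simp add: W_def)
    also have "\<dots> = card Y ^ card X"
      by (subst (2) X) (use fin ij in simp)
    also have "\<dots> = card (X \<rightarrow>\<^sub>E Y)" using fin by (simp add: card_PiE)
    finally show ?thesis .
  qed
  then have "(\<Sum>z\<in>Z. card (P z)) * (card Z * card Z) = card Z * card (X \<rightarrow>\<^sub>E Y)"
    by (simp add: sum_distrib_right)
  ultimately have *: "card Z * (card {H \<in> X \<rightarrow>\<^sub>E Y. c (H i) = c (H j)} * card Z) = card Z * card (X \<rightarrow>\<^sub>E Y)"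
    by (simp add: mult_ac)
  show ?thesis
  proof (cases "card Z = 0")
    case True
    then have "Y = {}" using fin c by auto
    then show ?thesis using ij fin True by (auto simp: card_PiE)
  next
    case False
    then show ?thesis using * by simp
  qed
qed

text \<open>Markov's inequality: each \<open>j\<close> collides with \<open>i\<close> with
  probability \<open>1 / card Z\<close>, so the expected weight that falls together with
  \<open>i\<close> is at most \<open>1 / card Z\<close>.\<close>

lemma card_noisy_collisions:
  fixes c :: "'b \<Rightarrow> 'c" and v :: "'a \<Rightarrow> real"
  assumes fin: "finite X" "finite Y" "finite Z" and i: "i \<in> X" and "Z \<noteq> {}"
    and c: "\<And>y. y \<in> Y \<Longrightarrow> c y \<in> Z"
    and unif: "\<And>z. z \<in> Z \<Longrightarrow> card {y \<in> Y. c y = z} * card Z = card Y"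
    and v: "\<And>j. j \<in> X \<Longrightarrow> v j \<ge> 0" "sum v X \<le> 1"
  shows "real (card {H \<in> X \<rightarrow>\<^sub>E Y. (\<Sum>j | j \<in> X \<and> j \<noteq> i \<and> c (H j) = c (H i). v j) \<ge> \<tau>}) * \<tau>
    \<le> real (card (X \<rightarrow>\<^sub>E Y)) / real (card Z)"
proof -
  let ?\<H> = "X \<rightarrow>\<^sub>E Y"
  define \<nu> where "\<nu> H = (\<Sum>j | j \<in> X \<and> j \<noteq> i \<and> c (H j) = c (H i). v j)" for H
  have finH: "finite ?\<H>" using fin by (intro finite_PiE) auto
  have \<nu>0: "\<nu> H \<ge> 0" for H unfolding \<nu>_def by (intro sum_nonneg) (use v in auto)
  have "real (card {H \<in> ?\<H>. \<nu> H \<ge> \<tau>}) * \<tau> = (\<Sum>H | H \<in> ?\<H> \<and> \<nu> H \<ge> \<tau>. \<tau>)" by simp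
  also have "\<dots> \<le> (\<Sum>H | H \<in> ?\<H> \<and> \<nu> H \<ge> \<tau>. \<nu> H)" by (intro sum_mono) auto
  also have "\<dots> \<le> (\<Sum>H\<in>?\<H>. \<nu> H)" by (intro sum_mono2 finH) (use \<nu>0 in auto)
  also have "\<dots> = (\<Sum>H\<in>?\<H>. \<Sum>j\<in>X - {i}. if c (H j) = c (H i) then v j else 0)"
    unfolding \<nu>_def using fin by (intro sum.cong refl sum.mono_neutral_cong_left) auto
  also have "\<dots> = (\<Sum>j\<in>X - {i}. \<Sum>H\<in>?\<H>. if c (H j) = c (H i) then v j else 0)"
    by (rule sum.swap)
  also have "\<dots> = (\<Sum>j\<in>X - {i}. v j * (real (card ?\<H>) / real (card Z)))"
  proof (rule sum.cong[OF refl])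
    fix j assume j: "j \<in> X - {i}"
    have "(\<Sum>H\<in>?\<H>. if c (H j) = c (H i) then v j else 0) = v j * card {H \<in> ?\<H>. c (H j) = c (H i)}"
      using finH by (simp flip: sum.inter_filter)
    also have "card {H \<in> ?\<H>. c (H j) = c (H i)} * card Z = card ?\<H>"
      by (rule card_collisions) (use j i fin c unif in auto)
    then have "real (card {H \<in> ?\<H>. c (H j) = c (H i)}) * real (card Z) = real (card ?\<H>)"
      by (simp only: flip: of_nat_mult)
    then have "real (card {H \<in> ?\<H>. c (H j) = c (H i)}) = real (card ?\<H>) / real (card Z)"
      using fin \<open>Z \<noteq> {}\<close> by (simp add: field_simps)
    finally show "(\<Sum>H\<in>?\<H>. if c (H j) = c (H i) then v j else 0) = v j * (real (card ?\<H>) / real (card Z))" .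
  qed
  also have "\<dots> = sum v (X - {i}) * (real (card ?\<H>) / real (card Z))"
    by (rule sum_distrib_right[symmetric])
  also have "\<dots> \<le> 1 * (real (card ?\<H>) / real (card Z))"
    using sum_mono2[of X "X - {i}" v] fin v by (intro mult_right_mono) auto
  finally show ?thesis by (simp add: \<nu>_def)
qed

lemma card_mod_class:
  fixes a b z :: nat
  assumes "z < a"
  shows "card {y \<in> {..<a * b}. y mod a = z} = b"
proof -
  have "bij_betw (\<lambda>q. z + a * q) {..<b} {y \<in> {..<a * b}. y mod a = z}"
  proof (rule bij_betw_byWitness[where f' = "\<lambda>y. y div a"])
    show "\<forall>q\<in>{..<b}. (z + a * q) div a = q" using assms by simp
    show "\<forall>y\<in>{y \<in> {..<a * b}. y mod a = z}. z + a * (y div a) = y" by auto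
    show "(\<lambda>q. z + a * q) ` {..<b} \<subseteq> {y \<in> {..<a * b}. y mod a = z}"
    proof (clarsimp simp: assms)
      fix q assume "q < b"
      then have "a * (q + 1) \<le> a * b" by (intro mult_le_mono2) simp
      then show "z + a * q < a * b" using assms by simp
    qed
    show "(\<lambda>y. y div a) ` {y \<in> {..<a * b}. y mod a = z} \<subseteq> {..<b}"
      by (auto simp: less_mult_imp_div_less mult.commute)
  qed
  then show ?thesis using bij_betw_same_card by fastforce
qed

lemma card_majority_bad:
  assumes G: "finite G" and B: "B \<subseteq> G" "16 * card B \<le> card G"
  shows "real (card {g \<in> {..<R} \<rightarrow>\<^sub>E G. R \<le> 2 * card {r. r < R \<and> g r \<in> B}}) * 2 ^ R
    \<le> real (card ({..<R} \<rightarrow>\<^sub>E G))"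
proof -
  let ?\<G> = "{..<R} \<rightarrow>\<^sub>E G"
  \<comment> \<open>Exponential moment of the number of bad entries, with the base \<open>16\<close> matched to their density.\<close>
  define w where "w h = (if h \<in> B then 16 else 1 :: real)" for h
  have fin: "finite ?\<G>" using G by (intro finite_PiE) auto
  have prod: "(\<Prod>r<R. w (g r)) = 16 ^ card {r. r < R \<and> g r \<in> B}" for g
  proof -
    have "(\<Prod>r<R. w (g r)) = (\<Prod>r | r \<in> {..<R} \<and> g r \<in> B. 16)"
      unfolding w_def by (rule prod.inter_filter[symmetric]) simp
    then show ?thesis by simp
  qed
  have "real (card {g \<in> ?\<G>. R \<le> 2 * card {r. r < R \<and> g r \<in> B}}) * 4 ^ R
      = (\<Sum>g | g \<in> ?\<G> \<and> R \<le> 2 * card {r. r < R \<and> g r \<in> B}. 4 ^ R)" by simp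
  also have "\<dots> \<le> (\<Sum>g | g \<in> ?\<G> \<and> R \<le> 2 * card {r. r < R \<and> g r \<in> B}. \<Prod>r<R. w (g r))"
  proof (rule sum_mono)
    fix g assume "g \<in> {g. g \<in> ?\<G> \<and> R \<le> 2 * card {r. r < R \<and> g r \<in> B}}"
    \<comment> \<open>When at least half of the entries are bad, the product is at least
      \<open>16\<close> to the power \<open>R / 2\<close>, which is \<open>4 ^ R\<close>.\<close>
    then have "(4::real) ^ R \<le> 4 ^ (2 * card {r. r < R \<and> g r \<in> B})" by (intro power_increasing) auto
    then show "4 ^ R \<le> (\<Prod>r<R. w (g r))" by (simp add: prod power_mult)
  qed
  also have "\<dots> \<le> (\<Sum>g\<in>?\<G>. \<Prod>r<R. w (g r))"
    by (intro sum_mono2 fin) (auto simp: prod)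
  also have "\<dots> = (\<Prod>r<R. \<Sum>h\<in>G. w h)"
    using prod_sum_PiE[of "{..<R}" "\<lambda>_. G" "\<lambda>_. w"] G by simp
  also have "\<dots> = (\<Sum>h\<in>G. w h) ^ R" by simp
  \<comment> \<open>With at most one bad element in sixteen the mean of \<open>w\<close> is at most
    \<open>1 + 15/16 < 2\<close>. The moment is thus at most \<open>2 ^ R\<close> against the
    threshold \<open>4 ^ R\<close>.\<close>
  also have "\<dots> \<le> (2 * real (card G)) ^ R"
  proof (rule power_mono)
    have "(\<Sum>h\<in>G. w h) = (\<Sum>h\<in>G. 1 + (if h \<in> B then 15 else 0))"
      by (rule sum.cong) (auto simp: w_def)
    also have "\<dots> = real (card G) + 15 * real (card B)"
      using G B(1) by (simp add: sum.distrib Int_absorb1 flip: sum.inter_restrict)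
    also have "\<dots> \<le> 2 * real (card G)" using B(2) by linarith
    finally show "(\<Sum>h\<in>G. w h) \<le> 2 * real (card G)" .
    show "0 \<le> (\<Sum>h\<in>G. w h)" by (intro sum_nonneg) (auto simp: w_def)
  qed
  also have "\<dots> = real (card ?\<G>) * 2 ^ R"
    using G by (simp add: card_PiE power_mult_distrib mult.commute)
  finally have "(real (card {g \<in> ?\<G>. R \<le> 2 * card {r. r < R \<and> g r \<in> B}}) * 2 ^ R) * 2 ^ R
      \<le> real (card ?\<G>) * 2 ^ R"
    by (simp add: mult.assoc flip: power_mult_distrib)
  then show ?thesis by (rule mult_right_le_imp_le) simp
qed

text \<open>In modulus, the numerator differs from \<open>a i\<close> times the denominator by at
  most a quarter of \<open>f i\<close>, and the denominator is at least three quarters of it. The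
  quotient is within 1/3 of the integer \<open>a i\<close>, and rounding is exact.\<close>

lemma round_weighted_quotient:
  fixes f :: "'a \<Rightarrow> real" and a :: "'a \<Rightarrow> nat"
  assumes C: "finite C" "i \<in> C" and a: "\<And>j. j \<in> C \<Longrightarrow> real (a j) \<le> B" and B: "B \<ge> 1"
    and f: "f i \<noteq> 0" and small: "(\<Sum>j\<in>C - {i}. \<bar>f j\<bar>) \<le> \<bar>f i\<bar> / (4 * B)"
  shows "nat (round ((\<Sum>j\<in>C. real (a j) * f j) / (\<Sum>j\<in>C. f j))) = a i"
proof -
  define \<nu> where "\<nu> = (\<Sum>j\<in>C - {i}. \<bar>f j\<bar>)"
  define W S where "W = (\<Sum>j\<in>C. real (a j) * f j)" and "S = (\<Sum>j\<in>C. f j)"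
  have "4 * (B * \<nu>) \<le> \<bar>f i\<bar>" using small B by (simp add: \<nu>_def field_simps)
  moreover have "\<nu> \<ge> 0" by (simp add: \<nu>_def sum_nonneg)
  then have "\<nu> \<le> B * \<nu>" using B mult_right_mono[of 1 B \<nu>] by simp
  ultimately have \<nu>: "4 * \<nu> \<le> \<bar>f i\<bar>" "4 * (B * \<nu>) \<le> \<bar>f i\<bar>" by auto
  have "W - real (a i) * S = (\<Sum>j\<in>C. (real (a j) - real (a i)) * f j)"
    by (simp add: W_def S_def sum_distrib_left left_diff_distrib sum_subtractf)
  also have "\<dots> = (\<Sum>j\<in>C - {i}. (real (a j) - real (a i)) * f j)"
    using C by (simp add: sum.remove)
  finally have "\<bar>W - real (a i) * S\<bar> \<le> (\<Sum>j\<in>C - {i}. \<bar>real (a j) - real (a i)\<bar> * \<bar>f j\<bar>)"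
    by (simp add: sum_abs flip: abs_mult)
  also have "\<dots> \<le> (\<Sum>j\<in>C - {i}. B * \<bar>f j\<bar>)"
  proof (intro sum_mono mult_right_mono)
    fix j assume "j \<in> C - {i}"
    then show "\<bar>real (a j) - real (a i)\<bar> \<le> B" using a[of j] a[of i] C by auto
  qed simp
  also have "\<dots> = B * \<nu>" by (simp add: \<nu>_def sum_distrib_left)
  finally have 1: "\<bar>W - real (a i) * S\<bar> \<le> \<bar>f i\<bar> / 4" using \<nu>(2) by simp
  have "S = f i + (\<Sum>j\<in>C - {i}. f j)" unfolding S_def by (rule sum.remove) (use C in auto)
  moreover have "\<bar>\<Sum>j\<in>C - {i}. f j\<bar> \<le> \<nu>" unfolding \<nu>_def by (rule sum_abs)
  ultimately have 2: "\<bar>S\<bar> \<ge> 3/4 * \<bar>f i\<bar>" using \<nu>(1) by linarith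
  then have S: "\<bar>S\<bar> > 0" using f by auto
  have "\<bar>W / S - real (a i)\<bar> = \<bar>W - real (a i) * S\<bar> / \<bar>S\<bar>"
    using S by (simp add: field_simps flip: abs_divide)
  also have "\<dots> < 1/2"
    using 1 2 S f by (simp add: pos_divide_less_eq)
  finally have "round (W / S) = int (a i)"
    by (intro round_unique') simp
  then show ?thesis by (simp add: W_def S_def)
qed

section \<open>Adaptive recovery of the large coordinates\<close>

text \<open>\<open>V\<close> is the base of the hash values, \<open>t\<close> the number of
  refinement steps, \<open>R\<close> the number of random groupings and \<open>D\<close> the maximal
  number of cells that are followed.\<close>

locale heavy_hitters =
  fixes m V t R D :: nat
  assumes V: "V > 0" and D: "D > 0" and m: "m > 0" "m \<le> V ^ 2 ^ t"
begin

text \<open>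
  The hash value of a coordinate is a number below \<open>cells t\<close>; its cell at level \<open>k\<close> is the residue modulo
  \<open>cells k\<close>. At level \<open>t\<close> the digit read off is the coordinate itself, as \<open>m \<le> digits t\<close>.
\<close>

definition cells :: "nat \<Rightarrow> nat" where "cells k = V ^ (2 ^ k + 1)"

definition digits :: "nat \<Rightarrow> nat" where "digits k = V ^ 2 ^ k"

definition cell_sum :: "(nat \<Rightarrow> nat) \<Rightarrow> nat \<Rightarrow> nat \<Rightarrow> (nat \<Rightarrow> nat) \<Rightarrow> (nat \<Rightarrow> real) \<Rightarrow> real" where
  "cell_sum H k p w f = (\<Sum>j | j < m \<and> H j mod cells k = p. real (w j) * f j)"

text \<open>The quotient estimates the weight of the dominating coordinate of the cell. If there is
  none, or the denominator vanishes, the result is a meaningless but well-defined number, with which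
  the method carries on.\<close>

definition ratio :: "(nat \<Rightarrow> nat) \<Rightarrow> nat \<Rightarrow> nat \<Rightarrow> (nat \<Rightarrow> nat) \<Rightarrow> (nat \<Rightarrow> real) \<Rightarrow> nat" where
  "ratio H k p w f = nat (round (cell_sum H k p w f / cell_sum H k p (\<lambda>_. 1) f))"

primrec cell_path :: "(nat \<Rightarrow> nat) \<Rightarrow> nat \<Rightarrow> nat \<Rightarrow> (nat \<Rightarrow> real) \<Rightarrow> nat" where
  "cell_path H b 0 f = b"
| "cell_path H b (Suc k) f = cell_path H b k f +
     cells k * ratio H k (cell_path H b k f) (\<lambda>j. H j div cells k mod digits k) f"

definition locate :: "(nat \<Rightarrow> nat) \<Rightarrow> nat \<Rightarrow> (nat \<Rightarrow> real) \<Rightarrow> nat" where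
  "locate H b f = ratio H t (cell_path H b t f) (\<lambda>j. j) f"

definition group_sum :: "(nat \<Rightarrow> nat) \<Rightarrow> (nat \<Rightarrow> nat) \<Rightarrow> nat \<Rightarrow> (nat \<Rightarrow> real) \<Rightarrow> real" where
  "group_sum H h d f = (\<Sum>j | j < m \<and> h (H j mod cells 0) = d. f j)"

text \<open>When the noise is below \<open>1 / D\<close>, the threshold \<open>2 / D\<close>
  separates cell sums of modulus at least \<open>3 / D\<close> from those of at most
  \<open>1 / D\<close>. The majority vote tolerates groupings with larger noise.\<close>

definition flagged :: "(nat \<Rightarrow> nat) \<Rightarrow> (nat \<Rightarrow> nat \<Rightarrow> nat) \<Rightarrow> (nat \<Rightarrow> real) \<Rightarrow> nat \<Rightarrow> bool" where
  "flagged H g f b \<longleftrightarrow> R < 2 * card {r. r < R \<and> \<bar>group_sum H (g r) (g r b) f\<bar> \<ge> 2 / D}"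

text \<open>Truncation bounds the number of measurements for every outcome; in the good case it
  removes nothing, as shown in \<open>mem_flags\<close>.\<close>

definition flags :: "(nat \<Rightarrow> nat) \<Rightarrow> (nat \<Rightarrow> nat \<Rightarrow> nat) \<Rightarrow> (nat \<Rightarrow> real) \<Rightarrow> nat list" where
  "flags H g f = take D (filter (flagged H g f) [0..<cells 0])"

definition recovery :: "(nat \<Rightarrow> nat) \<Rightarrow> (nat \<Rightarrow> nat \<Rightarrow> nat) \<Rightarrow> (nat \<Rightarrow> real) \<Rightarrow> nat \<Rightarrow> real" where
  "recovery H g f = (\<lambda>i\<in>{..<m}. if \<exists>b\<in>set (flags H g f). locate H b f = i then f i else 0)"

lemma cells_Suc: "cells (Suc k) = cells k * digits k"
  by (simp add: cells_def digits_def mult_2 power_add)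

lemma cells_pos: "cells k > 0" and digits_pos: "digits k > 0"
  using V by (simp_all add: cells_def digits_def)

text \<open>The surplus factor \<open>V\<close> is the safety margin: the expected noise in a cell
  is at most \<open>1 / cells k\<close>, while a coordinate of size \<open>4 / D\<close> tolerates
  \<open>1 / (D * digits k)\<close>.\<close>

lemma cells_eq: "cells k = V * digits k"
  by (simp add: cells_def digits_def)

lemma cells_dvd: "k \<le> l \<Longrightarrow> cells k dvd cells l"
  unfolding cells_def by (intro le_imp_power_dvd) (simp add: power_increasing)

section \<open>Counting the measurements\<close>

lemma computable_cell_sum: "computable 1 (ell_1 m) (cell_sum H k p w)"
  using computable_subset_sum[where m = m and P = "\<lambda>j. H j mod cells k = p" and w = "\<lambda>j. real (w j)"]
  by (simp add: cell_sum_def[abs_def])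

lemma computable_ratio: "computable 2 (ell_1 m) (ratio H k p w)"
proof -
  have "computable (1 + 1) (ell_1 m) (\<lambda>f. (\<lambda>s f. nat (round (s / cell_sum H k p (\<lambda>_. 1) f))) (cell_sum H k p w f) f)"
    by (rule computable_bind[OF computable_cell_sum]) (rule computable_map[OF computable_cell_sum])
  then show ?thesis by (simp add: ratio_def[abs_def] numeral_2_eq_2)
qed

lemma computable_cell_path: "computable (2 * k) (ell_1 m) (cell_path H b k)"
proof (induction k)
  case 0
  then show ?case by simp
next
  case (Suc k)
  have "computable (2 * k + 2) (ell_1 m)
      (\<lambda>f. (\<lambda>p f. p + cells k * ratio H k p (\<lambda>j. H j div cells k mod digits k) f) (cell_path H b k f) f)"
    by (rule computable_bind[OF Suc]) (rule computable_map[OF computable_ratio])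
  then show ?case by (simp add: cell_path_def)
qed

lemma computable_locate: "computable (2 * t + 2) (ell_1 m) (locate H b)"
proof -
  have "computable (2 * t + 2) (ell_1 m) (\<lambda>f. (\<lambda>p f. ratio H t p (\<lambda>j. j) f) (cell_path H b t f) f)"
    by (rule computable_bind[OF computable_cell_path computable_ratio])
  then show ?thesis by (simp add: locate_def[abs_def])
qed

lemma computable_entry: "computable 1 (ell_1 m) (\<lambda>f. if i < m then f i else 0)"
proof -
  have "(\<Sum>j | j < m \<and> j = i. 1 * f j) = (if i < m then f i else 0)" for f :: "nat \<Rightarrow> real"
  proof -
    have "{j. j < m \<and> j = i} = (if i < m then {i} else {})" by auto
    then show ?thesis by simp
  qed
  then show ?thesis using computable_subset_sum[where m = m and P = "\<lambda>j. j = i" and w = "\<lambda>_. 1"] by simp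
qed

text \<open>Two measurements for each of the \<open>t\<close> refinements, two for the index and one
  for the entry. The index may be out of range when decoding fails, hence the default 0.\<close>

lemma computable_located_entry:
  "computable (2 * t + 3) (ell_1 m) (\<lambda>f. (locate H b f, if locate H b f < m then f (locate H b f) else 0))"
proof -
  have "computable ((2 * t + 2) + 1) (ell_1 m)
      (\<lambda>f. (\<lambda>i f. (i, if i < m then f i else 0)) (locate H b f) f)"
    by (rule computable_bind[OF computable_locate]) (rule computable_map[OF computable_entry])
  then show ?thesis by (simp add: numeral_3_eq_3)
qed

text \<open>The table of all group sums is measured first; the flags of all cells are read off from
  it without further measurements.\<close>

lemma computable_flags:
  assumes g: "\<And>r b. r < R \<Longrightarrow> b < cells 0 \<Longrightarrow> g r b < 16 * D"
  shows "computable (16 * D * R) (ell_1 m) (flags H g)"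
proof -
  define tab where "tab f = map (\<lambda>r. map (\<lambda>d. group_sum H (g r) d f) [0..<16 * D]) [0..<R]" for f
  have "computable 1 (ell_1 m) (group_sum H h d)" for h d
    using computable_subset_sum[where m = m and P = "\<lambda>j. h (H j mod cells 0) = d" and w = "\<lambda>_. 1"]
    by (simp add: group_sum_def[abs_def])
  then have "computable (1 * length [0..<16 * D] * length [0..<R]) (ell_1 m) tab"
    unfolding tab_def by (intro computable_map_list)
  then have "computable (16 * D * R) (ell_1 m) tab" by simp
  then have "computable (16 * D * R) (ell_1 m) (\<lambda>f. take D (filter
      (\<lambda>b. R < 2 * card {r. r < R \<and> \<bar>tab f ! r ! g r b\<bar> \<ge> 2 / D}) [0..<cells 0]))"
    by (rule computable_map)
  moreover have "flags H g f = take D (filter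
      (\<lambda>b. R < 2 * card {r. r < R \<and> \<bar>tab f ! r ! g r b\<bar> \<ge> 2 / D}) [0..<cells 0])" for f
  proof -
    have "flagged H g f b = (R < 2 * card {r. r < R \<and> \<bar>tab f ! r ! g r b\<bar> \<ge> 2 / D})"
      if "b < cells 0" for b
    proof -
      have "{r. r < R \<and> \<bar>group_sum H (g r) (g r b) f\<bar> \<ge> 2 / D} = {r. r < R \<and> \<bar>tab f ! r ! g r b\<bar> \<ge> 2 / D}"
        using g[OF _ that] by (auto simp: tab_def)
      then show ?thesis by (simp add: flagged_def)
    qed
    then show ?thesis unfolding flags_def by (intro arg_cong[where f = "take D"] filter_cong) auto
  qed
  ultimately show ?thesis by (simp add: computable_cong)
qed

lemma computable_recovery:
  assumes g: "\<And>r b. r < R \<Longrightarrow> b < cells 0 \<Longrightarrow> g r b < 16 * D"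
    and n: "16 * D * R + (2 * t + 3) * D \<le> n"
  shows "computable n (ell_1 m) (recovery H g)"
proof -
  define entry where "entry b f = (locate H b f, if locate H b f < m then f (locate H b f) else 0)"
    for b and f :: "nat \<Rightarrow> real"
  \<comment> \<open>Several cells may yield the same index; their entries agree, so it does not
    matter which one \<open>map_of\<close> picks.\<close>
  define assemble where "assemble ps = (\<lambda>i\<in>{..<m}. case map_of ps i of None \<Rightarrow> 0 | Some v \<Rightarrow> v)"
    for ps :: "(nat \<times> real) list"
  \<comment> \<open>\<open>computable_bind\<close> asks for a count that is valid for every list of
    cells, hence the extra \<open>take D\<close>, which leaves \<open>flags\<close>
    unchanged.\<close>
  have list: "computable ((2 * t + 3) * D) (ell_1 m) (\<lambda>f. assemble (map (\<lambda>b. entry b f) (take D bs)))" for bs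
  proof -
    have "computable ((2 * t + 3) * length (take D bs)) (ell_1 m) (\<lambda>f. map (\<lambda>b. entry b f) (take D bs))"
      unfolding entry_def by (rule computable_map_list[OF computable_located_entry])
    then have "computable ((2 * t + 3) * D) (ell_1 m) (\<lambda>f. map (\<lambda>b. entry b f) (take D bs))"
      by (rule computable_mono) (simp only: mult_le_mono length_take min.cobounded2 le_refl min.cobounded1)
    then show ?thesis by (rule computable_map)
  qed
  have "computable (16 * D * R + (2 * t + 3) * D) (ell_1 m)
      (\<lambda>f. (\<lambda>bs f. assemble (map (\<lambda>b. entry b f) (take D bs))) (flags H g f) f)"
    by (rule computable_bind[OF computable_flags list]) (rule g)
  moreover have "recovery H g f = assemble (map (\<lambda>b. entry b f) (take D (flags H g f)))" for f
  proof -
    have "map_of (map (\<lambda>b. entry b f) bs) i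
        = (if \<exists>b\<in>set bs. locate H b f = i then Some (if i < m then f i else 0) else None)" for i bs
      by (induction bs) (auto simp: entry_def)
    moreover have "take D (flags H g f) = flags H g f" by (simp add: flags_def)
    ultimately show ?thesis by (auto simp: recovery_def assemble_def fun_eq_iff)
  qed
  ultimately have "computable (16 * D * R + (2 * t + 3) * D) (ell_1 m) (recovery H g)"
    by (simp add: computable_cong)
  then show ?thesis using n by (rule computable_mono)
qed

section \<open>Measurability of the recovered vector\<close>

lemma measurable_sum_vecs:
  "(\<lambda>f. \<Sum>j | j < m \<and> P j. w j * f j) \<in> borel_measurable (borel_vecs (ell_1 m))"
proof -
  have "(\<lambda>f. f j) \<in> borel_measurable (borel_vecs (ell_1 m))" if "j < m" for j
    using that by (intro measurable_component_vecs) simp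
  then show ?thesis by (intro borel_measurable_sum borel_measurable_times) auto
qed

lemma measurable_ratio: "ratio H k p w \<in> measurable (borel_vecs (ell_1 m)) (count_space UNIV)"
proof -
  have [measurable]: "cell_sum H k p w \<in> borel_measurable (borel_vecs (ell_1 m))" for w
    using measurable_sum_vecs[where P = "\<lambda>j. H j mod cells k = p" and w = "\<lambda>j. real (w j)"]
    by (simp add: cell_sum_def[abs_def])
  show ?thesis unfolding ratio_def[abs_def] round_def by measurable
qed

text \<open>The functional used next depends on the cell found so far. Cells form a countable set,
  so it suffices to check measurability with the cell fixed.\<close>

lemma measurable_cell_path:
  "cell_path H b k \<in> measurable (borel_vecs (ell_1 m)) (count_space UNIV)"
proof (induction k)
  case 0
  then show ?case by simp
next
  case (Suc k)
  have "(\<lambda>f. (\<lambda>p f. p + cells k * ratio H k p (\<lambda>j. H j div cells k mod digits k) f) (cell_path H b k f) f)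
      \<in> measurable (borel_vecs (ell_1 m)) (count_space UNIV)"
    by (rule measurable_compose_countable[OF _ Suc]) (rule measurable_compose[OF measurable_ratio], simp)
  then show ?case by (simp add: cell_path_def)
qed

lemma measurable_locate: "locate H b \<in> measurable (borel_vecs (ell_1 m)) (count_space UNIV)"
proof -
  have "(\<lambda>f. (\<lambda>p f. ratio H t p (\<lambda>j. j) f) (cell_path H b t f) f)
      \<in> measurable (borel_vecs (ell_1 m)) (count_space UNIV)"
    by (rule measurable_compose_countable[OF measurable_ratio measurable_cell_path])
  then show ?thesis by (simp add: locate_def[abs_def])
qed

lemma measurable_flags: "flags H g \<in> measurable (borel_vecs (ell_1 m)) (count_space UNIV)"
proof -
  let ?B = "borel_vecs (ell_1 m)"
  have [measurable]: "group_sum H h d \<in> borel_measurable ?B" for h d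
    using measurable_sum_vecs[where P = "\<lambda>j. h (H j mod cells 0) = d" and w = "\<lambda>_. 1"]
    by (simp add: group_sum_def[abs_def])
  have [measurable]: "Measurable.pred ?B (\<lambda>f. flagged H g f b)" for b
  proof -
    have "card {r. r < R \<and> \<bar>group_sum H (g r) (g r b) f\<bar> \<ge> 2 / D}
        = (\<Sum>r<R. if \<bar>group_sum H (g r) (g r b) f\<bar> \<ge> 2 / D then 1 else 0)" for f
      by (simp flip: sum.inter_filter)
    then show ?thesis unfolding flagged_def by simp
  qed
  have "(\<lambda>f. filter (flagged H g f) xs) \<in> measurable ?B (count_space UNIV)" for xs
  proof (induction xs)
    case (Cons x xs)
    have "(\<lambda>f. x # filter (flagged H g f) xs) \<in> measurable ?B (count_space UNIV)"
      by (rule measurable_compose[OF Cons]) simp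
    then show ?case using Cons by simp
  qed simp
  then show ?thesis unfolding flags_def[abs_def] by (rule measurable_compose) simp
qed

lemma measurable_recovery: "recovery H g \<in> measurable (borel_vecs (ell_1 m)) (borel_vecs (ell_infty m))"
proof -
  let ?B = "borel_vecs (ell_1 m)"
  have "(\<lambda>f. if \<exists>b\<in>set (flags H g f). locate H b f = i then f i else 0) \<in> borel_measurable ?B"
    if "i < m" for i
  proof -
    have [measurable]: "(\<lambda>f. f i) \<in> borel_measurable ?B"
      using that by (intro measurable_component_vecs) simp
    have [measurable]: "Measurable.pred ?B (\<lambda>f. locate H b f = i)" for b
      using measurable_locate by measurable
    have "Measurable.pred ?B (\<lambda>f. \<exists>b\<in>set bs. locate H b f = i)" for bs
      by (intro pred_intros_finite) auto
    then have [measurable]: "Measurable.pred ?B (\<lambda>f. \<exists>b\<in>set (flags H g f). locate H b f = i)"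
      by (rule measurable_compose_countable[OF _ measurable_flags])
    show ?thesis by measurable
  qed
  then show ?thesis
    unfolding recovery_def[abs_def] borel_vecs_def dim_ell by (intro measurable_restrict) (simp add: borel_vecs_def)
qed

section \<open>Correct decoding under small noise\<close>

definition cell_noise :: "(nat \<Rightarrow> nat) \<Rightarrow> nat \<Rightarrow> (nat \<Rightarrow> real) \<Rightarrow> nat \<Rightarrow> real" where
  "cell_noise H k f i = (\<Sum>j | j \<in> {..<m} \<and> j \<noteq> i \<and> H j mod cells k = H i mod cells k. \<bar>f j\<bar>)"

text \<open>The groupings act on the vector of cell sums at level 0, so cells take the place that
  coordinates have in \<open>cell_noise\<close>.\<close>

definition group_noise :: "(nat \<Rightarrow> nat) \<Rightarrow> (nat \<Rightarrow> nat) \<Rightarrow> (nat \<Rightarrow> real) \<Rightarrow> nat \<Rightarrow> real" where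
  "group_noise H h f b =
     (\<Sum>b' | b' \<in> {..<cells 0} \<and> b' \<noteq> b \<and> h b' = h b. \<bar>cell_sum H 0 b' (\<lambda>_. 1) f\<bar>)"

text \<open>Only coordinates of size at least \<open>4 / D\<close> have to be found; for these the
  bound is what \<open>round_weighted_quotient\<close> requires with \<open>digits k\<close> for
  \<open>B\<close>.\<close>

definition good_cells :: "(nat \<Rightarrow> nat) \<Rightarrow> (nat \<Rightarrow> real) \<Rightarrow> bool" where
  "good_cells H f \<longleftrightarrow> (\<forall>i<m. \<bar>f i\<bar> \<ge> 4 / D \<longrightarrow>
     (\<forall>k\<le>t. cell_noise H k f i < \<bar>f i\<bar> / (4 * real (digits k))))"

definition good_groups :: "(nat \<Rightarrow> nat) \<Rightarrow> (nat \<Rightarrow> nat \<Rightarrow> nat) \<Rightarrow> (nat \<Rightarrow> real) \<Rightarrow> bool" where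
  "good_groups H g f \<longleftrightarrow> (\<forall>b<cells 0. 2 * card {r. r < R \<and> group_noise H (g r) f b \<ge> 1 / D} < R)"

lemma ratio_eq:
  assumes i: "i < m" "f i \<noteq> 0" and w: "\<And>j. j < m \<Longrightarrow> w j \<le> digits k"
    and noise: "cell_noise H k f i < \<bar>f i\<bar> / (4 * real (digits k))"
  shows "ratio H k (H i mod cells k) w f = w i"
proof -
  define C where "C = {j. j < m \<and> H j mod cells k = H i mod cells k}"
  have "C - {i} = {j. j \<in> {..<m} \<and> j \<noteq> i \<and> H j mod cells k = H i mod cells k}"
    by (auto simp: C_def)
  then have "(\<Sum>j\<in>C - {i}. \<bar>f j\<bar>) \<le> \<bar>f i\<bar> / (4 * real (digits k))"
    using noise by (simp add: cell_noise_def)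
  moreover have "finite C" "i \<in> C" using i by (auto simp: C_def)
  moreover have "real (w j) \<le> real (digits k)" if "j \<in> C" for j using w that by (simp add: C_def)
  moreover have "real (digits k) \<ge> 1" using digits_pos[of k] by linarith
  ultimately have "nat (round ((\<Sum>j\<in>C. real (w j) * f j) / (\<Sum>j\<in>C. f j))) = w i"
    using i by (intro round_weighted_quotient)
  then show ?thesis by (simp add: ratio_def cell_sum_def C_def)
qed

text \<open>By induction the path follows the cells of \<open>i\<close>, since each quotient gives
  the next digit of \<open>H i\<close>. At the last level the weights are the coordinates
  themselves.\<close>

lemma locate_eq:
  assumes i: "i < m" "f i \<noteq> 0"
    and noise: "\<And>k. k \<le> t \<Longrightarrow> cell_noise H k f i < \<bar>f i\<bar> / (4 * real (digits k))"
  shows "locate H (H i mod cells 0) f = i"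
proof -
  have path: "cell_path H (H i mod cells 0) k f = H i mod cells k" if "k \<le> t" for k
    using that
  proof (induction k)
    case (Suc k)
    have "ratio H k (H i mod cells k) (\<lambda>j. H j div cells k mod digits k) f = H i div cells k mod digits k"
      by (rule ratio_eq[where i = i and f = f and H = H and w = "\<lambda>j. H j div cells k mod digits k", OF i]) (use noise Suc digits_pos[of k] in \<open>auto intro: less_imp_le\<close>)
    then show ?case using Suc by (simp add: cells_Suc mod_mult2_eq)
  qed simp
  have "m \<le> digits t" using m by (simp add: digits_def)
  then have "ratio H t (H i mod cells t) (\<lambda>j. j) f = i"
    by (intro ratio_eq[where w = "\<lambda>j. j"] i noise) auto
  then show ?thesis by (simp add: locate_def path)
qed

text \<open>Cancellation within a cell only lowers the norm, so the vector of cell sums can itself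
  be hashed with \<open>card_noisy_collisions\<close>.\<close>

lemma sum_abs_cell_sum:
  assumes "(\<Sum>i<m. \<bar>f i\<bar>) \<le> 1"
  shows "(\<Sum>b<cells 0. \<bar>cell_sum H 0 b (\<lambda>_. 1) f\<bar>) \<le> 1"
proof -
  have "(\<Sum>b<cells 0. \<bar>cell_sum H 0 b (\<lambda>_. 1) f\<bar>)
      \<le> (\<Sum>b<cells 0. \<Sum>j | j \<in> {..<m} \<and> H j mod cells 0 = b. \<bar>f j\<bar>)"
    by (rule sum_mono) (simp add: cell_sum_def sum_abs)
  also have "\<dots> = (\<Sum>j<m. \<bar>f j\<bar>)"
    by (rule sum.group) (use cells_pos in auto)
  finally show ?thesis using assms by linarith
qed

lemma group_sum_close:
  assumes b: "b < cells 0"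
  shows "\<bar>group_sum H h (h b) f - cell_sum H 0 b (\<lambda>_. 1) f\<bar> \<le> group_noise H h f b"
proof -
  let ?y = "\<lambda>b. cell_sum H 0 b (\<lambda>_. 1) f"
  let ?S = "{b'. b' < cells 0 \<and> h b' = h b}"
  have "group_sum H h (h b) f = (\<Sum>b'\<in>?S. \<Sum>j | j \<in> {j. j < m \<and> h (H j mod cells 0) = h b} \<and> H j mod cells 0 = b'. f j)"
    unfolding group_sum_def by (rule sum.group[symmetric]) (use cells_pos in auto)
  also have "\<dots> = (\<Sum>b'\<in>?S. ?y b')"
    by (intro sum.cong refl) (auto simp: cell_sum_def intro!: sum.cong)
  also have "\<dots> = ?y b + (\<Sum>b'\<in>?S - {b}. ?y b')"
    by (rule sum.remove) (use b in auto)
  finally have "\<bar>group_sum H h (h b) f - ?y b\<bar> \<le> (\<Sum>b'\<in>?S - {b}. \<bar>?y b'\<bar>)"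
    by (simp add: sum_abs)
  also have "?S - {b} = {b'. b' \<in> {..<cells 0} \<and> b' \<noteq> b \<and> h b' = h b}" by auto
  finally show ?thesis by (simp add: group_noise_def)
qed

text \<open>A large cell is flagged because more than half of the groupings show at least
  \<open>2 / D\<close> for it. The same majority argument shows that every flagged cell sum exceeds
  \<open>1 / D\<close>, so there are at most \<open>D\<close> of them and \<open>take D\<close>
  keeps them all.\<close>

lemma mem_flags:
  assumes f: "(\<Sum>i<m. \<bar>f i\<bar>) \<le> 1" and good: "good_groups H g f"
    and b: "b < cells 0" and large: "\<bar>cell_sum H 0 b (\<lambda>_. 1) f\<bar> \<ge> 3 / D"
  shows "b \<in> set (flags H g f)"
proof -
  let ?y = "\<lambda>b. cell_sum H 0 b (\<lambda>_. 1) f"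
  let ?bad = "\<lambda>b. {r. r < R \<and> group_noise H (g r) f b \<ge> 1 / D}"
  let ?hit = "\<lambda>b. {r. r < R \<and> \<bar>group_sum H (g r) (g r b) f\<bar> \<ge> 2 / D}"
  have bad: "2 * card (?bad b) < R" if "b < cells 0" for b
    using good that by (simp add: good_groups_def)
  have "{..<R} - ?bad b \<subseteq> ?hit b"
  proof
    fix r assume r: "r \<in> {..<R} - ?bad b"
    then have "\<bar>?y b\<bar> - \<bar>group_sum H (g r) (g r b) f\<bar> < 1 / D"
      using group_sum_close[OF b, of H "g r" f] by auto
    then show "r \<in> ?hit b" using r large by (auto simp: diff_less_eq field_simps)
  qed
  then have "card ({..<R} - ?bad b) \<le> card (?hit b)" by (intro card_mono) auto
  moreover have "card ({..<R} - ?bad b) = R - card (?bad b)"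
    by (subst card_Diff_subset) auto
  ultimately have fl: "flagged H g f b" using bad[OF b] by (simp add: flagged_def)
  have big: "\<bar>?y c\<bar> > 1 / D" if c: "c < cells 0" "flagged H g f c" for c
  proof (rule ccontr)
    assume small: "\<not> ?thesis"
    have "?hit c \<subseteq> ?bad c"
    proof
      fix r assume r: "r \<in> ?hit c"
      have "\<bar>group_sum H (g r) (g r c) f\<bar> - \<bar>?y c\<bar> \<le> group_noise H (g r) f c"
        using group_sum_close[OF c(1), of H "g r" f] by linarith
      then show "r \<in> ?bad c" using r small by (auto simp: field_simps)
    qed
    then have "card (?hit c) \<le> card (?bad c)" by (intro card_mono) auto
    then show False using bad[OF c(1)] c(2) by (simp add: flagged_def)
  qed
  define F where "F = filter (flagged H g f) [0..<cells 0]"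
  have "real (length F) * (1 / D) = (\<Sum>c\<in>set F. 1 / D)"
    by (simp add: F_def distinct_card[symmetric])
  also have "\<dots> \<le> (\<Sum>c\<in>set F. \<bar>?y c\<bar>)"
    by (intro sum_mono less_imp_le big) (auto simp: F_def)
  also have "\<dots> \<le> (\<Sum>c<cells 0. \<bar>?y c\<bar>)"
    by (intro sum_mono2) (auto simp: F_def)
  also have "\<dots> \<le> 1" by (rule sum_abs_cell_sum[OF f])
  finally have "length F \<le> D" using D by (simp add: field_simps)
  then have "flags H g f = F" by (simp add: flags_def F_def)
  then show ?thesis using fl b by (simp add: F_def)
qed

text \<open>Located entries are exact, so errors come only from coordinates that are not located. In
  the good case these are below \<open>4 / D\<close>: for a larger one, noise cancels at most a
  quarter, which leaves \<open>3 / D\<close> in its cell and gets the cell flagged.\<close>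

lemma input_error_recovery:
  assumes f: "(\<Sum>i<m. \<bar>f i\<bar>) \<le> 1"
  shows "input_error m (recovery H g) f \<le> (if good_cells H f \<and> good_groups H g f then 4 / D else 1)"
proof -
  have "\<bar>recovery H g f i - f i\<bar> \<le> (if good_cells H f \<and> good_groups H g f then 4 / D else 1)"
    if i: "i < m" for i
  proof (cases "\<exists>b\<in>set (flags H g f). locate H b f = i")
    case True
    then show ?thesis using i by (simp add: recovery_def)
  next
    case False
    have "\<bar>f i\<bar> \<le> (\<Sum>i<m. \<bar>f i\<bar>)" by (rule member_le_sum) (use i in auto)
    with f have fi: "\<bar>f i\<bar> \<le> 1" by linarith
    have "\<bar>f i\<bar> < 4 / D" if good: "good_cells H f" "good_groups H g f"
    proof (rule ccontr)
      assume "\<not> ?thesis"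
      then have large: "\<bar>f i\<bar> \<ge> 4 / D" by simp
      then have noise: "cell_noise H k f i < \<bar>f i\<bar> / (4 * real (digits k))" if "k \<le> t" for k
        using good(1) i that by (simp add: good_cells_def)
      have "\<bar>f i\<bar> > 0" using large D by (auto intro: less_le_trans[rotated])
      then have loc: "locate H (H i mod cells 0) f = i"
        by (intro locate_eq noise i) auto
      let ?C = "{j. j < m \<and> H j mod cells 0 = H i mod cells 0}"
      have "cell_sum H 0 (H i mod cells 0) (\<lambda>_. 1) f = f i + (\<Sum>j\<in>?C - {i}. f j)"
        using i by (simp add: cell_sum_def sum.remove)
      moreover have "\<bar>\<Sum>j\<in>?C - {i}. f j\<bar> \<le> cell_noise H 0 f i"
      proof -
        have "{j. j \<in> {..<m} \<and> j \<noteq> i \<and> H j mod cells 0 = H i mod cells 0} = ?C - {i}" by auto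
        then show ?thesis by (simp only: cell_noise_def sum_abs)
      qed
      moreover have "cell_noise H 0 f i < \<bar>f i\<bar> / 4"
      proof -
        have "real (digits 0) \<ge> 1" using digits_pos[of 0] by linarith
        then have "\<bar>f i\<bar> / (4 * real (digits 0)) \<le> \<bar>f i\<bar> / 4"
          by (intro divide_left_mono) auto
        then show ?thesis using noise[of 0] by simp
      qed
      ultimately have "\<bar>cell_sum H 0 (H i mod cells 0) (\<lambda>_. 1) f\<bar> \<ge> 3/4 * \<bar>f i\<bar>" by linarith
      then have "\<bar>cell_sum H 0 (H i mod cells 0) (\<lambda>_. 1) f\<bar> \<ge> 3 / D" using large by simp
      then have "H i mod cells 0 \<in> set (flags H g f)"
        using cells_pos[of 0] by (intro mem_flags f good) auto
      with loc False show False by blast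
    qed
    then show ?thesis using False i fi by (auto simp: recovery_def)
  qed
  moreover have "{..<m} \<noteq> {}" using m(1) by auto
  ultimately show ?thesis
    by (auto simp: input_error_def ell_infty_def vec_diff_def)
qed

section \<open>Probability of failure\<close>

text \<open>The range \<open>cells t\<close> is a multiple of every \<open>cells k\<close> with
  \<open>k \<le> t\<close>, so a uniform hash value has uniform residues at all levels.\<close>

definition hashes :: "(nat \<Rightarrow> nat) set" where
  "hashes = {..<m} \<rightarrow>\<^sub>E {..<cells t}"

text \<open>With \<open>16 * D\<close> groups, noise of \<open>1 / D\<close> has probability at most
  1/16, the density that \<open>card_majority_bad\<close> allows.\<close>

definition groupings :: "(nat \<Rightarrow> nat) set" where
  "groupings = {..<cells 0} \<rightarrow>\<^sub>E {..<16 * D}"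

lemma finite_hashes: "finite hashes" and finite_groupings: "finite groupings"
  by (simp_all add: hashes_def groupings_def finite_PiE)

text \<open>The threshold is at least \<open>1 / (D * digits k)\<close> and the mean noise at most
  \<open>1 / (V * digits k)\<close>, so Markov's inequality gives \<open>D / V\<close>.\<close>

lemma card_bad_cell:
  assumes f: "(\<Sum>i<m. \<bar>f i\<bar>) \<le> 1" and i: "i < m" "\<bar>f i\<bar> \<ge> 4 / D" and k: "k \<le> t"
  shows "real (card {H \<in> hashes. cell_noise H k f i \<ge> \<bar>f i\<bar> / (4 * real (digits k))})
    \<le> real (card hashes) * (D / V)"
proof -
  obtain q where q: "cells t = cells k * q" using cells_dvd[OF k] by (auto elim: dvdE)
  let ?\<tau> = "\<bar>f i\<bar> / (4 * real (digits k))"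
  let ?bad = "{H \<in> hashes. cell_noise H k f i \<ge> ?\<tau>}"
  have B: "real (digits k) > 0" using digits_pos by simp
  have "real (card ?bad) * ?\<tau> \<le> real (card hashes) / real (card {..<cells k})"
    unfolding hashes_def cell_noise_def
    by (rule card_noisy_collisions[where c = "\<lambda>y. y mod cells k"])
      (use f i cells_pos[of k] q in \<open>auto simp: card_mod_class[simplified] lessThan_empty_iff\<close>)
  also have "real (card {..<cells k}) = real V * real (digits k)" by (simp add: cells_eq)
  finally have "real (card ?bad) * ?\<tau> \<le> real (card hashes) / (real V * real (digits k))" .
  moreover have "real (card ?bad) * (1 / (D * real (digits k))) \<le> real (card ?bad) * ?\<tau>"
    using i(2) D B by (intro mult_left_mono) (auto simp: field_simps)
  ultimately have "real (card ?bad) * (1 / (D * real (digits k))) \<le> real (card hashes) / (real V * real (digits k))"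
    by linarith
  then show ?thesis using B D V by (simp add: field_simps)
qed

lemma card_bad_groups:
  assumes f: "(\<Sum>i<m. \<bar>f i\<bar>) \<le> 1" and b: "b < cells 0"
  shows "real (card {g \<in> {..<R} \<rightarrow>\<^sub>E groupings. R \<le> 2 * card {r. r < R \<and> group_noise H (g r) f b \<ge> 1 / D}}) * 2 ^ R
    \<le> real (card ({..<R} \<rightarrow>\<^sub>E groupings))"
proof -
  define Bd where "Bd = {h \<in> groupings. group_noise H h f b \<ge> 1 / D}"
  have "real (card Bd) * (1 / D) \<le> real (card groupings) / real (card {..<16 * D})"
    unfolding Bd_def groupings_def group_noise_def
  proof (rule card_noisy_collisions[where c = "\<lambda>y. y"])
    fix z assume "z \<in> {..<16 * D}"
    then have "{y \<in> {..<16 * D}. y = z} = {z}" by auto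
    then show "card {y \<in> {..<16 * D}. y = z} * card {..<16 * D} = card {..<16 * D}" by simp
  qed (use b D sum_abs_cell_sum[OF f] in \<open>auto simp: lessThan_empty_iff\<close>)
  then have "real (16 * card Bd) \<le> real (card groupings)" using D by (simp add: field_simps)
  then have "real (card {g \<in> {..<R} \<rightarrow>\<^sub>E groupings. R \<le> 2 * card {r. r < R \<and> g r \<in> Bd}}) * 2 ^ R
      \<le> real (card ({..<R} \<rightarrow>\<^sub>E groupings))"
    by (intro card_majority_bad finite_groupings) (auto simp: Bd_def simp del: of_nat_mult)
  moreover have "{r. r < R \<and> group_noise H (g r) f b \<ge> 1 / D} = {r. r < R \<and> g r \<in> Bd}"
    if "g \<in> {..<R} \<rightarrow>\<^sub>E groupings" for g
    using that by (auto simp: Bd_def PiE_iff)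
  then have "{g \<in> {..<R} \<rightarrow>\<^sub>E groupings. R \<le> 2 * card {r. r < R \<and> group_noise H (g r) f b \<ge> 1 / D}}
      = {g \<in> {..<R} \<rightarrow>\<^sub>E groupings. R \<le> 2 * card {r. r < R \<and> g r \<in> Bd}}"
    by (intro Collect_cong) auto
  ultimately show ?thesis by simp
qed

text \<open>Union bound: over at most \<open>D\<close> large coordinates with \<open>t + 1\<close>
  levels each, and, for each fixed hash function, over the \<open>cells 0\<close> cells to be
  grouped.\<close>

lemma card_bad_event:
  assumes f: "(\<Sum>i<m. \<bar>f i\<bar>) \<le> 1"
  shows "real (card {(H, g) \<in> hashes \<times> ({..<R} \<rightarrow>\<^sub>E groupings). \<not> (good_cells H f \<and> good_groups H g f)})
    \<le> real (card (hashes \<times> ({..<R} \<rightarrow>\<^sub>E groupings))) *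
       ((real D)\<^sup>2 * (t + 1) / V + real (cells 0) / 2 ^ R)"
proof -
  let ?G = "{..<R} \<rightarrow>\<^sub>E groupings"
  define heavy where "heavy = {i. i < m \<and> \<bar>f i\<bar> \<ge> 4 / D}"
  define bc where "bc i k = {H \<in> hashes. cell_noise H k f i \<ge> \<bar>f i\<bar> / (4 * real (digits k))}" for i k
  define bg where "bg H b = {g \<in> ?G. R \<le> 2 * card {r. r < R \<and> group_noise H (g r) f b \<ge> 1 / D}}" for H b
  define BC where "BC = (\<Union>i\<in>heavy. \<Union>k\<in>{..t}. bc i k)"
  define BG where "BG H = (\<Union>b<cells 0. bg H b)" for H
  have fin: "finite hashes" "finite ?G" "finite heavy" "\<And>i k. finite (bc i k)" "\<And>H b. finite (bg H b)"
    using finite_hashes finite_groupings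
    by (auto simp: heavy_def bc_def bg_def finite_PiE)
  have finB: "finite BC" "\<And>H. finite (BG H)"
    unfolding BC_def BG_def by (intro finite_UN_I fin finite_atMost finite_lessThan)+
  have heavy: "real (card heavy) \<le> D"
  proof -
    have "real (card heavy) * (4 / D) = (\<Sum>i\<in>heavy. 4 / D)" by simp
    also have "\<dots> \<le> (\<Sum>i\<in>heavy. \<bar>f i\<bar>)" by (intro sum_mono) (auto simp: heavy_def)
    also have "\<dots> \<le> (\<Sum>i<m. \<bar>f i\<bar>)" by (intro sum_mono2) (auto simp: heavy_def)
    also have "\<dots> \<le> 1" by (rule f)
    finally have "real (card heavy) * 4 \<le> real D" using D by (simp add: field_simps)
    then show ?thesis by linarith
  qed
  have "real (card BC) \<le> real (\<Sum>i\<in>heavy. card (\<Union>k\<in>{..t}. bc i k))"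
    unfolding BC_def of_nat_le_iff by (rule card_UN_le[OF fin(3)])
  also have "\<dots> \<le> (\<Sum>i\<in>heavy. \<Sum>k\<in>{..t}. real (card (bc i k)))"
    unfolding of_nat_sum by (intro sum_mono) (simp only: of_nat_le_iff card_UN_le finite_atMost flip: of_nat_sum)
  also have "\<dots> \<le> (\<Sum>i\<in>heavy. \<Sum>k\<in>{..t}. real (card hashes) * (D / V))"
    unfolding bc_def by (intro sum_mono card_bad_cell[OF f]) (auto simp: heavy_def)
  also have "\<dots> = real (card heavy) * ((t + 1) * (real (card hashes) * (D / V)))" by simp
  also have "\<dots> \<le> D * ((t + 1) * (real (card hashes) * (D / V)))"
    by (intro mult_right_mono heavy) auto
  finally have BC: "real (card BC) \<le> real (card hashes) * ((real D)\<^sup>2 * (t + 1) / V)"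
    by (simp add: power2_eq_square field_simps)
  have BG: "real (card (BG H)) \<le> real (card ?G) * (real (cells 0) / 2 ^ R)" for H
  proof -
    have "real (card (BG H)) \<le> (\<Sum>b<cells 0. real (card (bg H b)))"
      unfolding BG_def by (simp only: of_nat_le_iff card_UN_le finite_lessThan flip: of_nat_sum)
    also have "\<dots> \<le> (\<Sum>b<cells 0. real (card ?G) / 2 ^ R)"
      using card_bad_groups[OF f, of _ H] by (intro sum_mono) (simp add: bg_def field_simps)
    finally show ?thesis by (simp add: field_simps)
  qed
  have "{(H, g) \<in> hashes \<times> ?G. \<not> (good_cells H f \<and> good_groups H g f)} \<subseteq> BC \<times> ?G \<union> Sigma hashes BG"
    by (fastforce simp: BC_def BG_def bc_def bg_def heavy_def good_cells_def good_groups_def not_less)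
  then have "card {(H, g) \<in> hashes \<times> ?G. \<not> (good_cells H f \<and> good_groups H g f)}
      \<le> card (BC \<times> ?G \<union> Sigma hashes BG)"
    by (intro card_mono finite_UnI finite_cartesian_product finite_SigmaI fin finB)
  also have "\<dots> \<le> card (BC \<times> ?G) + card (Sigma hashes BG)" by (rule card_Un_le)
  finally have "real (card {(H, g) \<in> hashes \<times> ?G. \<not> (good_cells H f \<and> good_groups H g f)})
      \<le> real (card BC) * real (card ?G) + (\<Sum>H\<in>hashes. real (card (BG H)))"
    using fin finB by (simp add: card_cartesian_product flip: of_nat_mult of_nat_sum of_nat_add)
  also have "\<dots> \<le> (real (card hashes) * ((real D)\<^sup>2 * (t + 1) / V)) * real (card ?G)
      + (\<Sum>H\<in>hashes. real (card ?G) * (real (cells 0) / 2 ^ R))"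
    by (intro add_mono mult_right_mono sum_mono BC BG) simp
  also have "\<dots> = real (card (hashes \<times> ?G)) * ((real D)\<^sup>2 * (t + 1) / V + real (cells 0) / 2 ^ R)"
    by (simp add: card_cartesian_product algebra_simps)
  finally show ?thesis .
qed

theorem e_ran_ada_bound:
  assumes n: "16 * D * R + (2 * t + 3) * D \<le> n"
  shows "e_ran_ada n (ell_1 m) (ell_infty m) (\<lambda>x. x)
    \<le> ennreal (4 / D + ((real D)\<^sup>2 * (t + 1) / V + real (cells 0) / 2 ^ R))"
proof (rule e_ran_ada_le[where A = "\<lambda>(H, g). recovery H g" and \<Omega> = "hashes \<times> ({..<R} \<rightarrow>\<^sub>E groupings)"])
  let ?\<Omega> = "hashes \<times> ({..<R} \<rightarrow>\<^sub>E groupings)"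
  show "m > 0" by (rule m)
  show fin: "finite ?\<Omega>" by (intro finite_cartesian_product finite_hashes finite_PiE finite_groupings) auto
  show "?\<Omega> \<noteq> {}"
    using cells_pos[of t] D by (auto simp: hashes_def groupings_def PiE_eq_empty_iff lessThan_empty_iff)
  show "computable n (ell_1 m) (case \<omega> of (H, g) \<Rightarrow> recovery H g)" if "\<omega> \<in> ?\<Omega>" for \<omega>
  proof -
    obtain H g where \<omega>: "\<omega> = (H, g)" "g \<in> {..<R} \<rightarrow>\<^sub>E groupings" using \<open>\<omega> \<in> ?\<Omega>\<close> by auto
    have "g r b < 16 * D" if "r < R" "b < cells 0" for r b
      using \<omega>(2) that by (auto simp: groupings_def PiE_iff)
    then show ?thesis unfolding \<omega> using n by (simp add: computable_recovery)
  qed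
  show "(case \<omega> of (H, g) \<Rightarrow> recovery H g) \<in> measurable (borel_vecs (ell_1 m)) (borel_vecs (ell_infty m))"
    for \<omega> :: "(nat \<Rightarrow> nat) \<times> (nat \<Rightarrow> nat \<Rightarrow> nat)"
    by (simp add: measurable_recovery split: prod.split)
  fix f assume "vnorm (ell_1 m) f \<le> 1"
  then have f: "(\<Sum>i<m. \<bar>f i\<bar>) \<le> 1" by (simp add: ell_1_def)
  let ?bad = "{(H, g) \<in> ?\<Omega>. \<not> (good_cells H f \<and> good_groups H g f)}"
  have "(\<Sum>\<omega>\<in>?\<Omega>. input_error m (case \<omega> of (H, g) \<Rightarrow> recovery H g) f)
      \<le> (\<Sum>\<omega>\<in>?\<Omega>. 4 / D + (if case \<omega> of (H, g) \<Rightarrow> \<not> (good_cells H f \<and> good_groups H g f) then 1 else 0))"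
  proof (rule sum_mono)
    fix \<omega> :: "(nat \<Rightarrow> nat) \<times> (nat \<Rightarrow> nat \<Rightarrow> nat)"
    obtain H g where \<omega>: "\<omega> = (H, g)" by (cases \<omega>)
    show "input_error m (case \<omega> of (H, g) \<Rightarrow> recovery H g) f
      \<le> 4 / D + (if case \<omega> of (H, g) \<Rightarrow> \<not> (good_cells H f \<and> good_groups H g f) then 1 else 0)"
      using input_error_recovery[OF f, of H g] unfolding \<omega> by (auto split: if_splits intro: order_trans)
  qed
  also have "\<dots> = real (card ?\<Omega>) * (4 / D) + real (card ?bad)"
  proof -
    have "?bad = {\<omega> \<in> ?\<Omega>. case \<omega> of (H, g) \<Rightarrow> \<not> (good_cells H f \<and> good_groups H g f)}" by auto
    then show ?thesis using fin by (simp add: sum.distrib flip: sum.inter_filter)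
  qed
  also have "\<dots> \<le> real (card ?\<Omega>) * (4 / D + ((real D)\<^sup>2 * (t + 1) / V + real (cells 0) / 2 ^ R))"
    using card_bad_event[OF f] by (simp add: distrib_left)
  finally show "(\<Sum>\<omega>\<in>?\<Omega>. input_error m (case \<omega> of (H, g) \<Rightarrow> recovery H g) f)
    \<le> real (card ?\<Omega>) * (4 / D + ((real D)\<^sup>2 * (t + 1) / V + real (cells 0) / 2 ^ R))" .
qed

end

section \<open>The gap\<close>

text \<open>The power is at most \<open>exp (16 * n\<^sup>2)\<close>, and the linear factors are
  absorbed by \<open>exp (4 * n\<^sup>2)\<close>, which accounts for the 20.\<close>

lemma nonadaptive_threshold:
  fixes n m :: nat
  assumes n: "n \<ge> 2" and m: "real m \<ge> exp (20 * (real n)\<^sup>2)"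
  shows "real m \<ge> real (4 * n) + 4 * (1 + real (4 * n)) ^ (4 * n)"
proof -
  define E where "E = exp (16 * (real n)\<^sup>2)"
  have "(1 + real (4 * n)) ^ (4 * n) \<le> exp (real (4 * n)) ^ (4 * n)"
    by (intro power_mono exp_ge_add_one_self) auto
  also have "\<dots> = E"
    by (simp add: E_def power2_eq_square mult_ac flip: exp_of_nat_mult)
  finally have 1: "(1 + real (4 * n)) ^ (4 * n) \<le> E" .
  have E: "E \<ge> 1" by (simp add: E_def)
  have "real n * real n \<ge> 2 * real n" using n by (intro mult_right_mono) auto
  moreover have "real n \<ge> 2" using n by simp
  ultimately have "4 + 4 * real n \<le> 1 + 4 * (real n)\<^sup>2" unfolding power2_eq_square by linarith
  also have "\<dots> \<le> exp (4 * (real n)\<^sup>2)" by (rule exp_ge_add_one_self)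
  finally have "(4 + 4 * real n) * E \<le> exp (4 * (real n)\<^sup>2) * E"
    using E by (intro mult_right_mono) auto
  also have "\<dots> = exp (20 * (real n)\<^sup>2)" by (simp add: E_def flip: exp_add)
  finally have "(4 + 4 * real n) * E \<le> real m" using m by linarith
  moreover have "4 * real n * 1 \<le> 4 * real n * E" using E by (intro mult_left_mono) auto
  ultimately show ?thesis using 1 by (simp add: algebra_simps)
qed

lemma adaptive_upper_bound:
  fixes n m L :: nat
  defines "D \<equiv> n div (160 * L)"
  assumes L: "L > 0" "n \<le> 2 ^ L" and D: "D > 0"
    and m: "m > 0" "real m \<le> 2 * exp (20 * (real n)\<^sup>2)"
  shows "e_ran_ada n (ell_1 m) (ell_infty m) (\<lambda>x. x) \<le> ennreal (12 / D)"
proof -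
  \<comment> \<open>The choice of \<open>t\<close> makes \<open>V ^ 2 ^ t\<close> at least
    \<open>2 ^ (64 * n\<^sup>2)\<close>, enough for \<open>m\<close>. \<open>V\<close> exceeds
    \<open>D\<^sup>2 * (t + 1)\<close> by the order of \<open>2 ^ L\<close>, and \<open>R\<close>
    exceeds the exponent \<open>8 * L\<close> of \<open>cells 0\<close> by \<open>L\<close>. Both
    failure terms are then of order \<open>1 / 2 ^ L\<close>, hence of order at most
    \<open>1 / D\<close>.\<close>
  define V t R where "V = (2 :: nat) ^ (4 * L)" and "t = 2 * L + 4" and "R = 9 * L"
  have n0: "n > 0" using D by (auto simp: D_def intro!: gr0I)
  have "exp (20 * (real n)\<^sup>2) = exp 1 ^ (20 * n\<^sup>2)"
    by (simp flip: exp_of_nat_mult)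
  also have "\<dots> \<le> (2 ^ 2) ^ (20 * n\<^sup>2)"
    using exp_le by (intro power_mono) auto
  also have "\<dots> = 2 ^ (40 * n\<^sup>2)" by (simp only: flip: power_mult) simp
  finally have "real m \<le> 2 ^ (40 * n\<^sup>2 + 1)" using m(2) by simp
  also have "\<dots> \<le> (2::real) ^ (4 * L * 2 ^ t)"
  proof (rule power_increasing)
    have "n\<^sup>2 \<le> (2 ^ L)\<^sup>2" using L by (intro power_mono) auto
    then have "64 * n\<^sup>2 \<le> 4 * 2 ^ t" by (simp add: t_def power_add power_mult power2_eq_square mult.commute)
    also have "\<dots> \<le> 4 * L * 2 ^ t" using L by simp
    finally have "64 * n\<^sup>2 \<le> 4 * L * 2 ^ t" .
    moreover have "n\<^sup>2 \<ge> 1" using n0 by simp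
    ultimately show "40 * n\<^sup>2 + 1 \<le> 4 * L * 2 ^ t" by linarith
  qed simp
  also have "\<dots> = real (V ^ 2 ^ t)" by (simp add: V_def power_mult)
  finally have mV: "m \<le> V ^ 2 ^ t" by linarith
  interpret heavy_hitters m V t R D
    by unfold_locales (use m mV D in \<open>auto simp: V_def\<close>)
  \<comment> \<open>Per followed cell, the groupings take \<open>144 * L\<close> measurements and
    the decoding \<open>4 * L + 11\<close>; the 160 covers both.\<close>
  have "16 * D * R + (2 * t + 3) * D = D * (148 * L + 11)"
    by (simp add: R_def t_def algebra_simps)
  also have "\<dots> \<le> D * (160 * L)" using L by (intro mult_le_mono2) linarith
  also have "\<dots> \<le> n" unfolding D_def by (rule div_times_less_eq_dividend)
  finally have "16 * D * R + (2 * t + 3) * D \<le> n" .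
  then have "e_ran_ada n (ell_1 m) (ell_infty m) (\<lambda>x. x)
      \<le> ennreal (4 / D + ((real D)\<^sup>2 * (t + 1) / V + real (cells 0) / 2 ^ R))"
    by (rule e_ran_ada_bound)
  also have "\<dots> \<le> ennreal (12 / D)"
  proof (rule ennreal_leI)
    have Dn: "D \<le> n" by (simp add: D_def)
    then have "D \<le> 2 ^ L" using L by linarith
    then have DL: "real D \<le> 2 ^ L" by (metis of_nat_le_iff of_nat_numeral of_nat_power)
    have "L < 2 ^ L" by (rule less_exp)
    then have "t + 1 \<le> 7 * 2 ^ L" unfolding t_def by linarith
    then have tL: "real (t + 1) \<le> 7 * 2 ^ L"
      by (metis of_nat_le_iff of_nat_mult of_nat_numeral of_nat_power)
    have "(real D)\<^sup>2 * (t + 1) \<le> (2 ^ L)\<^sup>2 * (7 * 2 ^ L)"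
      using DL tL by (intro mult_mono power_mono) auto
    also have "\<dots> * 2 ^ L = 7 * real V"
      by (simp add: V_def power2_eq_square flip: power_add)
    then have "(2 ^ L)\<^sup>2 * (7 * 2 ^ L) = 7 / 2 ^ L * real V" by (simp add: field_simps)
    finally have 1: "(real D)\<^sup>2 * (t + 1) / V \<le> 7 / 2 ^ L"
      using V by (simp add: divide_le_eq)
    have "cells 0 = V\<^sup>2" by (simp add: cells_def numeral_2_eq_2)
    then have "real (cells 0) * 2 ^ L = 2 ^ R"
      unfolding V_def R_def by (simp flip: power_mult power_add)
    then have "real (cells 0) / 2 ^ R = 1 / 2 ^ L" by (simp add: field_simps)
    moreover have "8 / 2 ^ L \<le> 8 / real D" using DL D by (intro divide_left_mono) auto
    ultimately show "4 / D + ((real D)\<^sup>2 * (t + 1) / V + real (cells 0) / 2 ^ R) \<le> 12 / D"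
      using 1 by simp
  qed
  finally show ?thesis .
qed

lemma adaptive_rate:
  fixes n m :: nat
  assumes n: "n \<ge> 3" "real n \<ge> 960 * ln (real n)"
    and m: "m > 0" "real m \<le> 2 * exp (20 * (real n)\<^sup>2)"
  shows "e_ran_ada n (ell_1 m) (ell_infty m) (\<lambda>x. x) \<le> ennreal (11520 * (ln (real n) / real n))"
proof -
  define L where "L = nat \<lceil>log 2 (real n)\<rceil>"
  define D where "D = n div (160 * L)"
  have ln: "ln (real n) \<ge> 1"
    using n exp_le by (subst ln_ge_iff) auto
  have "log 2 (real n) \<le> ln (real n) / (2/3)"
    unfolding log_def using ln ln2_ge_two_thirds by (intro divide_left_mono) auto
  with ln have log: "log 2 (real n) > 0" "log 2 (real n) + 1 \<le> 3 * ln (real n)"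
    using n(1) by auto
  then have L: "L > 0" "real L \<le> 3 * ln (real n)" "log 2 (real n) \<le> real L"
    by (auto simp: L_def) linarith+
  have "real n = 2 powr log 2 (real n)" using n by simp
  also have "\<dots> \<le> 2 powr real L" using L by (intro powr_mono) auto
  also have "\<dots> = real (2 ^ L)" by (simp add: powr_realpow)
  finally have nL: "n \<le> 2 ^ L" by linarith
  have "320 * real L \<le> real n" using L n by linarith
  then have nL': "320 * L \<le> n" by linarith
  \<comment> \<open>As \<open>n\<close> is at least \<open>320 * L\<close>, rounding down in
    \<open>D\<close> costs at most a factor 2.\<close>
  have "n < 160 * L * (D + 1)"
    using dividend_less_times_div[of "160 * L" n] L by (simp add: D_def)
  then have "n \<le> 320 * L * D"
    using nL' by (simp add: algebra_simps)
  then have nD: "real n \<le> 320 * real L * real D" by (metis of_nat_le_iff of_nat_mult of_nat_numeral)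
  then have D: "D > 0" using n by (intro gr0I) auto
  have "12 / real D \<le> 12 * (320 * real L) / real n"
    using nD D n by (simp add: field_simps)
  also have "\<dots> \<le> 11520 * (ln (real n) / real n)"
    using L n by (simp add: divide_right_mono)
  finally have "ennreal (12 / D) \<le> ennreal (11520 * (ln (real n) / real n))" by (rule ennreal_leI)
  with adaptive_upper_bound[OF L(1) nL _ m] D show ?thesis
    unfolding D_def by (meson order_trans)
qed

theorem theorem4p1:
  shows "\<exists>C>0. \<exists>a>0. \<exists>c>0. \<exists>n\<^sub>0::nat. \<forall>n\<ge>n\<^sub>0.
    (let m = nat \<lceil>C * exp (a * (real n)\<^sup>2)\<rceil>;
         ada = e_ran_ada n (ell_1 m) (ell_infty m) (\<lambda>x. x);
         nonada = e_ran_nonada n (ell_1 m) (ell_infty m) (\<lambda>x. x)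
     in nonada > 0 \<and> ada / nonada \<le> ennreal (c * (ln (real n) / real n)))"
proof -
  have "eventually (\<lambda>n::nat. real n \<ge> 960 * ln (real n)) sequentially" by real_asymp
  then obtain n\<^sub>0 where n\<^sub>0: "\<And>n. n \<ge> n\<^sub>0 \<Longrightarrow> real n \<ge> 960 * ln (real n)"
    by (auto simp: eventually_sequentially)
  have main: "let m = nat \<lceil>1 * exp (20 * (real n)\<^sup>2)\<rceil>;
         ada = e_ran_ada n (ell_1 m) (ell_infty m) (\<lambda>x. x);
         nonada = e_ran_nonada n (ell_1 m) (ell_infty m) (\<lambda>x. x)
     in nonada > 0 \<and> ada / nonada \<le> ennreal (184320 * (ln (real n) / real n))"
    if n: "n \<ge> max 3 n\<^sub>0" for n
  proof -
    define m where "m = nat \<lceil>1 * exp (20 * (real n)\<^sup>2)\<rceil>"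
    let ?ada = "e_ran_ada n (ell_1 m) (ell_infty m) (\<lambda>x. x)"
    let ?nonada = "e_ran_nonada n (ell_1 m) (ell_infty m) (\<lambda>x. x)"
    let ?E = "exp (20 * (real n)\<^sup>2)"
    have E: "?E \<ge> 1" by simp
    have "real m = of_int \<lceil>?E\<rceil>" using E by (simp add: m_def)
    \<comment> \<open>As the exponential is at least 1, the ceiling at most doubles it.\<close>
    then have m: "?E \<le> real m" "real m \<le> 2 * ?E" using E by linarith+
    then have m0: "m > 0" using E by (intro gr0I) simp
    have ln: "ln (real n) / real n \<ge> 0" using n by simp
    have non: "?nonada \<ge> ennreal (1/16)"
      by (rule e_ran_nonada_ge[OF _ nonadaptive_threshold]) (use n m in auto)
    then have pos: "?nonada > 0" by (rule less_le_trans[rotated]) simp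
    have "?ada \<le> ennreal (11520 * (ln (real n) / real n))"
      using n n\<^sub>0 m0 m by (intro adaptive_rate) auto
    also have "\<dots> = ennreal (1/16) * ennreal (184320 * (ln (real n) / real n))"
      using ln by (subst ennreal_mult[symmetric]) auto
    also have "\<dots> \<le> ?nonada * ennreal (184320 * (ln (real n) / real n))"
      by (rule mult_right_mono[OF non]) simp
    finally have "?ada / ?nonada \<le> ennreal (184320 * (ln (real n) / real n))"
      by (rule divide_le_posI_ennreal[OF pos])
    with pos show ?thesis unfolding m_def Let_def by blast
  qed
  show ?thesis
    \<comment> \<open>The witnesses are \<open>C = 1\<close> and \<open>a = 20\<close>; the constant
      \<open>184320 = 16 * 11520\<close> combines the lower bound 1/16 with the rate of the adaptive
      method.\<close>
    by (rule exI[of _ 1], rule conjI, simp, rule exI[of _ 20], rule conjI, simp,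
        rule exI[of _ 184320], rule conjI, simp, rule exI[of _ "max 3 n\<^sub>0"]) (use main in blast)
qed

end
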